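(* Fix a positive integer $k$, and for $q\in\mathbb N$ let $G_q=P_q^k$ be the Cartesian product of $k$ copies of the path $P_q$ with $q$ vertices. Then the chromatic polynomial $\chi_{G_q}(n)$ is a two-level polynomial of degree function $q^k$ and depth function $e(q)=q$.
   Context: $\mathbb N=\{0,1,2,\dots\}$. The Cartesian product $G\times H$ has vertices $(u,v)$ with $u\in V(G)$, $v\in V(H)$, and edges $(u,v)\sim(u,v')$ for $v\sim v'$ in $H$, and $(u,v)\sim(u',v)$ for $u\sim u'$ in $G$. The chromatic polynomial $\chi_G(n)$ counts colorings of the vertices of $G$ with $n$ colors such that adjacent vertices get different colors (it is $1$ for the graph with no vertices). A numerical polynomial is $g\in\mathbb Q[x]$ with $g(q)\in\mathbb Z$ for all $q\in\mathbb Z$. Two-level polynomial: let $g$ be an eventually nonnegative numerical polynomial, $S=\{q\in\mathbb N: g(q)\ge0\}$, $e:S\to\mathbb N\cup\{-1,\infty\}$. A two-level polynomial of degree function $g$ and depth function $e$ is a sequence of polynomials $\{f_q\}_{q\in S}$, $f_q(n)$ of degree $g(q)$, such that, writing $f_q(n)=\sum_{r\ge0}c_r(q)n^{g(q)-r}$ with $c_r(q)=0$ for $r>g(q)$, there exist polynomials $\{\phi_r(q)\}_{r\ge0}$ with $c_r(q)=\phi_r(q)$ for every $q\in S$ and every $r\le e(q)$. (The depth function is not claimed to be optimal.) *)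

theory Defs
  imports
    "HOL-Library.Extended_Real"
    "HOL-Library.FuncSet"
    "HOL-Computational_Algebra.Polynomial"
    "Graph_Theory.Pair_Digraph"
begin

section \<open>Graphs\<close>

text \<open>
  A finite simple graph is a digraph satisfying \<^locale>\<open>pair_graph\<close>: it is finite, symmetric and
  loop-free, every undirected edge being represented by the two arcs between its endpoints.
\<close>

definition path_graph :: "nat \<Rightarrow> nat pair_pre_digraph" where
  "path_graph q = \<lparr> pverts = {..<q},
     parcs = {(i, j). i < q \<and> j < q \<and> (j = Suc i \<or> i = Suc j)} \<rparr>"

definition cart_prod ::
  "'a pair_pre_digraph \<Rightarrow> 'b pair_pre_digraph \<Rightarrow> ('a \<times> 'b) pair_pre_digraph" where
  "cart_prod G H = \<lparr> pverts = pverts G \<times> pverts H,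
     parcs = {((u, v), (u', v')).
        u = u' \<and> u \<in> pverts G \<and> (v, v') \<in> parcs H \<or>
        v = v' \<and> v \<in> pverts H \<and> (u, u') \<in> parcs G} \<rparr>"

definition map_graph :: "('a \<Rightarrow> 'b) \<Rightarrow> 'a pair_pre_digraph \<Rightarrow> 'b pair_pre_digraph" where
  "map_graph h G = \<lparr> pverts = h ` pverts G, parcs = map_prod h h ` parcs G \<rparr>"

text \<open>
  The vertices of the \<open>k\<close>-fold product are represented as lists of length \<open>k\<close>, because the type
  of iterated pairs would depend on \<open>k\<close>. The empty product is the one-vertex graph.
\<close>

primrec cart_power :: "'a pair_pre_digraph \<Rightarrow> nat \<Rightarrow> 'a list pair_pre_digraph" where
  "cart_power G 0 = \<lparr> pverts = {[]}, parcs = {} \<rparr>"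
| "cart_power G (Suc k) = map_graph (\<lambda>(u, us). u # us) (cart_prod G (cart_power G k))"

lemma pair_graph_iff:
  "pair_graph G \<longleftrightarrow> finite (pverts G) \<and> parcs G \<subseteq> pverts G \<times> pverts G \<and> sym (parcs G) \<and> irrefl (parcs G)"
proof
  assume "pair_graph G"
  then interpret pair_graph G .
  show "finite (pverts G) \<and> parcs G \<subseteq> pverts G \<times> pverts G \<and> sym (parcs G) \<and> irrefl (parcs G)"
    using pair_finite_verts in_arcsD1 in_arcsD2 pair_sym_arcs no_loops'
    by (auto simp: symmetric_def irrefl_def) blast
next
  assume a: "finite (pverts G) \<and> parcs G \<subseteq> pverts G \<times> pverts G \<and> sym (parcs G) \<and> irrefl (parcs G)"
  then have "finite (parcs G)" by (meson finite_SigmaI finite_subset)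
  with a show "pair_graph G"
    by unfold_locales (auto simp: symmetric_def irrefl_def)
qed

lemma pair_graph_path_graph: "pair_graph (path_graph q)"
  unfolding pair_graph_iff by (auto simp: path_graph_def sym_def irrefl_def)

lemma pair_graph_cart_prod:
  "pair_graph G \<Longrightarrow> pair_graph H \<Longrightarrow> pair_graph (cart_prod G H)"
  unfolding pair_graph_iff by (auto simp: cart_prod_def sym_def irrefl_def)

lemma pair_graph_map_graph:
  assumes "inj h" "pair_graph G" shows "pair_graph (map_graph h G)"
  using assms unfolding pair_graph_iff
  by (auto simp: map_graph_def sym_def irrefl_def dest: injD)

lemma pair_graph_cart_power:
  assumes "pair_graph G" shows "pair_graph (cart_power G k)"
proof (induction k)
  case 0
  show ?case by (auto simp: pair_graph_iff sym_def irrefl_def)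
next
  case (Suc k)
  have "inj (\<lambda>(u :: 'a, us). u # us)" by (auto simp: inj_def)
  then show ?case using Suc assms by (simp add: pair_graph_map_graph pair_graph_cart_prod)
qed

lemma pverts_cart_power:
  "pverts (cart_power G k) = {us. length us = k \<and> set us \<subseteq> pverts G}"
proof (induction k)
  case (Suc k)
  then show ?case by (auto simp: map_graph_def cart_prod_def length_Suc_conv image_iff)
qed auto


section \<open>The chromatic polynomial\<close>

definition proper_colorings :: "'a pair_pre_digraph \<Rightarrow> nat \<Rightarrow> ('a \<Rightarrow> nat) set" where
  "proper_colorings G n = {c \<in> pverts G \<rightarrow>\<^sub>E {..<n}. \<forall>(u, v) \<in> parcs G. c u \<noteq> c v}"

definition chromatic_poly :: "'a pair_pre_digraph \<Rightarrow> rat poly" where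
  "chromatic_poly G = (THE p. \<forall>n. poly p (of_nat n) = of_nat (card (proper_colorings G n)))"

lemma poly_eqI_of_nat:
  fixes p p' :: "rat poly"
  assumes "\<And>n::nat. poly p (of_nat n) = poly p' (of_nat n)"
  shows "p = p'"
proof (rule ccontr)
  assume "p \<noteq> p'"
  then have "finite {x. poly (p - p') x = 0}" by (intro poly_roots_finite) auto
  moreover have "range of_nat \<subseteq> {x. poly (p - p') x = 0}" using assms by auto
  ultimately have "finite (range (of_nat :: nat \<Rightarrow> rat))" by (rule finite_subset[rotated])
  then show False using finite_imageD[of "of_nat :: nat \<Rightarrow> rat" UNIV] by (auto simp: inj_on_def)
qed

lemma binomial_polynomial:
  "\<exists>p :: rat poly. \<forall>n. poly p (of_nat n) = of_nat (n choose m)"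
proof -
  let ?p = "smult (1 / fact m) (\<Prod>i = 0..<m. [:- of_nat i, 1:]) :: rat poly"
  have "poly ?p (of_nat n) = of_nat (n choose m)" for n
    by (simp add: binomial_gbinomial gbinomial_prod_rev poly_prod)
  then show ?thesis by blast
qed

lemma card_colorings_onto:
  fixes B :: "nat set"
  assumes G: "pair_graph G" and B: "finite B"
  shows "card {c \<in> pverts G \<rightarrow>\<^sub>E B. (\<forall>(u, v) \<in> parcs G. c u \<noteq> c v) \<and> c ` pverts G = B} =
         card {c \<in> pverts G \<rightarrow>\<^sub>E {..<card B}. (\<forall>(u, v) \<in> parcs G. c u \<noteq> c v) \<and> c ` pverts G = {..<card B}}"
    (is "card ?X = card ?Y")
proof -
  let ?V = "pverts G"
  have arcs: "u \<in> ?V" "v \<in> ?V" if "(u, v) \<in> parcs G" for u v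
    using G that by (auto simp: pair_graph_iff)
  obtain h where h: "bij_betw h B {..<card B}"
    using ex_bij_betw_finite_nat[OF B] by (auto simp: lessThan_atLeast0)
  let ?g = "the_inv_into B h"
  have g: "bij_betw ?g {..<card B} B" using h by (rule bij_betw_the_inv_into)
  have trans: "restrict (f \<circ> c) ?V \<in> {c \<in> ?V \<rightarrow>\<^sub>E D. (\<forall>(u, v) \<in> parcs G. c u \<noteq> c v) \<and> c ` ?V = D}"
    if "bij_betw f C D" and "c \<in> {c \<in> ?V \<rightarrow>\<^sub>E C. (\<forall>(u, v) \<in> parcs G. c u \<noteq> c v) \<and> c ` ?V = C}"
    for f c and C D :: "nat set"
  proof -
    have c: "c \<in> ?V \<rightarrow>\<^sub>E C" "\<forall>(u, v) \<in> parcs G. c u \<noteq> c v" "c ` ?V = C" using that by auto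
    have f: "inj_on f C" "f ` C = D" using that by (auto simp: bij_betw_def)
    have "(restrict (f \<circ> c) ?V) ` ?V = f ` (c ` ?V)" by (auto simp: image_comp)
    then have im: "(restrict (f \<circ> c) ?V) ` ?V = D" using c f by simp
    have "restrict (f \<circ> c) ?V u \<noteq> restrict (f \<circ> c) ?V v" if uv: "(u, v) \<in> parcs G" for u v
    proof -
      have "c u \<in> C" "c v \<in> C" "c u \<noteq> c v" using c arcs[OF uv] uv by auto
      then show ?thesis using f arcs[OF uv] by (auto dest: inj_onD)
    qed
    moreover have "restrict (f \<circ> c) ?V \<in> ?V \<rightarrow>\<^sub>E D" using c f by auto
    ultimately show ?thesis using im by blast
  qed
  have "bij_betw (\<lambda>c. restrict (h \<circ> c) ?V) ?X ?Y"
  proof (rule bij_betw_byWitness[where f' = "\<lambda>c. restrict (?g \<circ> c) ?V"])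
    show "\<forall>c\<in>?X. restrict (?g \<circ> restrict (h \<circ> c) ?V) ?V = c"
    proof
      fix c assume "c \<in> ?X"
      then have "c \<in> ?V \<rightarrow>\<^sub>E B" by auto
      then show "restrict (?g \<circ> restrict (h \<circ> c) ?V) ?V = c"
        using h by (fastforce simp: fun_eq_iff restrict_def PiE_iff extensional_def
            bij_betw_def the_inv_into_f_f)
    qed
    show "\<forall>c\<in>?Y. restrict (h \<circ> restrict (?g \<circ> c) ?V) ?V = c"
    proof
      fix c assume "c \<in> ?Y"
      then have c: "c \<in> ?V \<rightarrow>\<^sub>E {..<card B}" by auto
      show "restrict (h \<circ> restrict (?g \<circ> c) ?V) ?V = c"
      proof
        fix x
        have "h (?g (c x)) = c x" if "x \<in> ?V"
          using f_the_inv_into_f_bij_betw[OF h] c that by (auto simp: PiE_iff)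
        then show "restrict (h \<circ> restrict (?g \<circ> c) ?V) ?V x = c x"
          using c by (auto simp: restrict_def PiE_iff extensional_def)
      qed
    qed
    show "(\<lambda>c. restrict (h \<circ> c) ?V) ` ?X \<subseteq> ?Y"
      using trans[OF h] by (intro image_subsetI) assumption
    show "(\<lambda>c. restrict (?g \<circ> c) ?V) ` ?Y \<subseteq> ?X"
      using trans[OF g] by (intro image_subsetI) assumption
  qed
  then show ?thesis by (rule bij_betw_same_card)
qed

lemma card_proper_colorings_polynomial:
  assumes G: "pair_graph G"
  shows "\<exists>p :: rat poly. \<forall>n. poly p (of_nat n) = of_nat (card (proper_colorings G n))"
proof -
  let ?V = "pverts G"
  have fV: "finite ?V" using G by (auto simp: pair_graph_iff)
  define onto where "onto B =
    {c \<in> ?V \<rightarrow>\<^sub>E B. (\<forall>(u, v) \<in> parcs G. c u \<noteq> c v) \<and> c ` ?V = B}" for B :: "nat set"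
  define a where "a m = card (onto {..<m})" for m
  have onto_card: "card (onto B) = a (card B)" if "finite B" for B
    using card_colorings_onto[OF G that] by (simp add: a_def onto_def)
  have fin: "finite (onto B)" if "finite B" for B
    using that fV unfolding onto_def by (simp add: finite_PiE)
  have a0: "a m = 0" if "m > card ?V" for m
  proof -
    have "c ` ?V \<noteq> {..<m}" for c :: "'a \<Rightarrow> nat"
      using card_image_le[OF fV, of c] that by (metis card_lessThan leD)
    then show ?thesis by (simp add: a_def onto_def)
  qed
  have count: "card (proper_colorings G n) = (\<Sum>m\<le>card ?V. a m * (n choose m))" for n
  proof -
    have "proper_colorings G n = (\<Union>B\<in>Pow {..<n}. onto B)"
      unfolding proper_colorings_def onto_def by (auto simp: PiE_iff)
    also have "card \<dots> = (\<Sum>B\<in>Pow {..<n}. card (onto B))"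
    proof (rule card_UN_disjoint)
      show "\<forall>B\<in>Pow {..<n}. finite (onto B)"
        by (auto intro!: fin intro: finite_subset[OF _ finite_lessThan])
    qed (auto simp: onto_def)
    also have "\<dots> = (\<Sum>B\<in>Pow {..<n}. a (card B))"
      by (intro sum.cong refl onto_card) (auto intro: finite_subset)
    also have "\<dots> = (\<Sum>m\<le>n. \<Sum>B\<in>{B \<in> Pow {..<n}. card B = m}. a (card B))"
    proof (rule sum.group[symmetric])
      show "card ` Pow {..<n} \<subseteq> {..n}"
        by (auto dest: card_mono[OF finite_lessThan])
    qed auto
    also have "\<dots> = (\<Sum>m\<le>n. a m * (n choose m))"
    proof (intro sum.cong refl)
      fix m
      have "card {B \<in> Pow {..<n}. card B = m} = n choose m"
        using n_subsets[of "{..<n}" m] by simp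
      then show "(\<Sum>B\<in>{B \<in> Pow {..<n}. card B = m}. a (card B)) = a m * (n choose m)"
        by simp
    qed
    also have "\<dots> = (\<Sum>m\<le>max n (card ?V). a m * (n choose m))"
      by (rule sum.mono_neutral_left) auto
    also have "\<dots> = (\<Sum>m\<le>card ?V. a m * (n choose m))"
      by (rule sum.mono_neutral_right) (auto simp: a0)
    finally show ?thesis .
  qed
  obtain b :: "nat \<Rightarrow> rat poly"
    where b: "poly (b m) (of_nat n) = of_nat (n choose m)" for m n
    using binomial_polynomial by metis
  have "poly (\<Sum>m\<le>card ?V. smult (of_nat (a m)) (b m)) (of_nat n) =
        of_nat (card (proper_colorings G n))" for n
    by (simp add: poly_sum b count)
  then show ?thesis by blast
qed

lemma poly_chromatic_poly:
  assumes "pair_graph G"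
  shows "poly (chromatic_poly G) (of_nat n) = of_nat (card (proper_colorings G n))"
proof -
  have "\<exists>!p :: rat poly. \<forall>n. poly p (of_nat n) = of_nat (card (proper_colorings G n))"
    using card_proper_colorings_polynomial[OF assms] by (auto intro: poly_eqI_of_nat)
  from theI'[OF this] show ?thesis unfolding chromatic_poly_def by blast
qed


section \<open>Two-level polynomials\<close>

definition numerical_poly :: "rat poly \<Rightarrow> bool" where
  "numerical_poly g \<longleftrightarrow> (\<forall>q :: int. poly g (of_int q) \<in> \<int>)"

definition eventually_nonneg_poly :: "rat poly \<Rightarrow> bool" where
  "eventually_nonneg_poly g \<longleftrightarrow> (\<forall>\<^sub>F q :: nat in sequentially. poly g (of_nat q) \<ge> 0)"

definition index_set :: "rat poly \<Rightarrow> nat set" where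
  "index_set g = {q. poly g (of_nat q) \<ge> 0}"

definition top_coeff :: "'a::zero poly \<Rightarrow> nat \<Rightarrow> 'a" where
  "top_coeff p r = (if r \<le> degree p then coeff p (degree p - r) else 0)"

text \<open>
  The depth function takes values in the set of natural numbers together with \<open>-1\<close> and \<open>\<infinity>\<close>,
  viewed inside \<^typ>\<open>ereal\<close>. The values of \<open>e\<close> and \<open>f\<close> outside \<^term>\<open>index_set g\<close> are
  irrelevant. The condition \<open>f q \<noteq> 0\<close> is needed since \<^term>\<open>degree 0 = 0\<close>.
\<close>

definition two_level_polynomial ::
  "rat poly \<Rightarrow> (nat \<Rightarrow> ereal) \<Rightarrow> (nat \<Rightarrow> rat poly) \<Rightarrow> bool" where
  "two_level_polynomial g e f \<longleftrightarrow>
     numerical_poly g \<and> eventually_nonneg_poly g \<and>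
     (\<forall>q\<in>index_set g. e q \<in> range (\<lambda>n :: nat. ereal (real n)) \<union> {-1, \<infinity>}) \<and>
     (\<forall>q\<in>index_set g. f q \<noteq> 0 \<and> of_nat (degree (f q)) = poly g (of_nat q)) \<and>
     (\<exists>\<phi> :: nat \<Rightarrow> rat poly. \<forall>q\<in>index_set g. \<forall>r. ereal (real r) \<le> e q \<longrightarrow>
        top_coeff (f q) r = poly (\<phi> r) (of_nat q))"

end

theory Submission
  imports Defs "HOL-Combinatorics.Transposition" "HOL-Computational_Algebra.Formal_Power_Series"
begin

text \<open>
  By Whitney's expansion, the coefficient of \<open>n ^ (|V| - r)\<close> in the chromatic polynomial is the sum of
  \<open>(-1) ^ |A|\<close> over the edge sets \<open>A\<close> of rank \<open>r\<close>, that is, the coefficient of \<open>t ^ r\<close> in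
  \<open>Z(t) = (\<Sum>A\<subseteq>E. (-1) ^ |A| t ^ rank A)\<close>. An edge set of rank \<open>r\<close> may consist of several components
  scattered over the grid, so counting such sets directly means controlling how the components avoid
  each other. Passing to the logarithmic derivative \<open>M = t Z' / Z\<close> removes this difficulty.

  Each coefficient \<open>M\<^sub>r\<close>, as a function of the edge set, is a sum over the subsets \<open>H\<close> of a weight
  \<open>w H\<close>. The weights have three properties.

  \<^item> They vanish when \<open>rank H > r\<close>: this is clear for \<open>Z\<^sub>r\<close>, and it passes to \<open>M\<^sub>r\<close> because the
    rank is subadditive, so that locality of degree \<open>d\<close> and \<open>d'\<close> multiplies to locality of degree
    \<open>d + d'\<close> (\<open>rank_local_mult\<close>, \<open>rank_local_log_deriv_series\<close>).
  \<^item> They vanish when \<open>H\<close> is disconnected: \<open>Z\<close> is multiplicative over vertex-disjoint unions, hence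
    \<open>M\<close> is additive (\<open>log_deriv_series_Un\<close>, \<open>weight_disconnected\<close>).
  \<^item> They are invariant under translation, since \<open>Z\<close> depends only on the isomorphism type
    (\<open>weight_image\<close>).

  So \<open>M\<^sub>r\<close> of the grid of side \<open>q\<close> is a weighted count of connected sets \<open>H\<close> of rank at most \<open>r\<close>. Such
  a set spans at most \<open>r\<close> steps in each coordinate direction (\<open>extent_le_rank\<close>), so there are finitely
  many shapes up to translation. A shape with extents \<open>a\<^sub>1, \<dots>, a\<^sub>k\<close> has \<open>\<Prod>i. (q - a\<^sub>i)\<close> positions in the
  grid as soon as \<open>q\<close> is at least all the \<open>a\<^sub>i\<close>, in particular when \<open>q \<ge> r\<close>; this is where the depth
  \<open>e(q) = q\<close> comes from. Hence \<open>M\<^sub>r\<close> is a polynomial in \<open>q \<ge> r\<close>. Newton's identity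
  \<open>r Z\<^sub>r = M\<^sub>1 Z\<^sub>r\<^sub>-\<^sub>1 + \<dots> + M\<^sub>r Z\<^sub>0\<close> transfers this to \<open>Z\<^sub>r\<close> by induction on \<open>r\<close>.

  Edge sets are arbitrary relations here: whether an edge is represented by one arc or by both does
  not change the set of proper colorings, and the expansion holds in either case.
\<close>

unbundle fps_syntax

section \<open>The rank of an edge set\<close>

text \<open>
  The equivalence relation whose classes are the connected components of the graph with edge set \<open>B\<close>.
\<close>

definition connection :: "'a rel \<Rightarrow> 'a rel" where
  "connection B = (B \<union> B\<inverse>)\<^sup>*"

lemma subset_connection: "B \<subseteq> connection B"
  by (auto simp: connection_def)

lemma connection_refl [simp]: "(x, x) \<in> connection B"
  by (simp add: connection_def)

lemma connection_sym: "(x, y) \<in> connection B \<Longrightarrow> (y, x) \<in> connection B"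
  unfolding connection_def by (metis converse_Un converse_converse rtrancl_converseI sup_commute)

lemma connection_trans:
  "(x, y) \<in> connection B \<Longrightarrow> (y, z) \<in> connection B \<Longrightarrow> (x, z) \<in> connection B"
  unfolding connection_def by (rule rtrancl_trans)

lemma connection_mono: "A \<subseteq> B \<Longrightarrow> connection A \<subseteq> connection B"
  unfolding connection_def by (intro rtrancl_mono) auto

lemma connection_subset: "A \<subseteq> connection B \<Longrightarrow> connection A \<subseteq> connection B"
proof -
  assume A: "A \<subseteq> connection B"
  then have "A \<union> A\<inverse> \<subseteq> connection B" by (auto intro: connection_sym)
  then show ?thesis
    unfolding connection_def by (metis rtrancl_subset_rtrancl)
qed

lemma connection_image:
  assumes "(x, y) \<in> connection B"
  shows "(h x, h y) \<in> connection (map_prod h h ` B)"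
  using assms unfolding connection_def
proof (induction rule: rtrancl_induct)
  case (step y z)
  then have "(h y, h z) \<in> map_prod h h ` B \<union> (map_prod h h ` B)\<inverse>" by force
  with step.IH show ?case by (rule rtrancl_into_rtrancl)
qed simp

lemma connection_const:
  assumes "(x, y) \<in> connection B" "\<And>u v. (u, v) \<in> B \<Longrightarrow> c u = c v"
  shows "c x = c y"
  using assms(1) unfolding connection_def by induction (auto dest: assms(2))

text \<open>
  The rank in the cycle matroid: the least number of edges of \<open>A\<close> that already connect everything
  connected by \<open>A\<close>, i.e. the size of a spanning forest. Defined as a minimum, its subadditivity and
  its invariance need no counting of components.
\<close>

definition rank :: "'a rel \<Rightarrow> nat" where
  "rank A = (LEAST m. \<exists>B\<subseteq>A. finite B \<and> A \<subseteq> connection B \<and> card B = m)"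

lemma rank_le: "B \<subseteq> A \<Longrightarrow> finite B \<Longrightarrow> A \<subseteq> connection B \<Longrightarrow> rank A \<le> card B"
  unfolding rank_def by (rule Least_le) auto

lemma rank_witness:
  assumes "finite A"
  obtains B where "B \<subseteq> A" "finite B" "A \<subseteq> connection B" "card B = rank A"
proof -
  have "\<exists>m. \<exists>B\<subseteq>A. finite B \<and> A \<subseteq> connection B \<and> card B = m"
    using assms subset_connection by blast
  from LeastI_ex[OF this] show ?thesis unfolding rank_def[symmetric] using that by blast
qed

lemma rank_Un_le:
  assumes "finite A" "finite A'"
  shows "rank (A \<union> A') \<le> rank A + rank A'"
proof -
  obtain B where B: "B \<subseteq> A" "finite B" "A \<subseteq> connection B" "card B = rank A"
    using rank_witness[OF assms(1)] .
  obtain B' where B': "B' \<subseteq> A'" "finite B'" "A' \<subseteq> connection B'" "card B' = rank A'"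
    using rank_witness[OF assms(2)] .
  have "rank (A \<union> A') \<le> card (B \<union> B')"
    using B B' connection_mono[of B "B \<union> B'"] connection_mono[of B' "B \<union> B'"]
    by (intro rank_le) auto
  also have "\<dots> \<le> card B + card B'" by (rule card_Un_le)
  finally show ?thesis using B B' by simp
qed

lemma rank_empty [simp]: "rank {} = 0"
  using rank_le[of "{}" "{}"] by simp

lemma rank_eq_0_iff:
  assumes "finite A" "irrefl A"
  shows "rank A = 0 \<longleftrightarrow> A = {}"
proof
  assume "rank A = 0"
  with rank_witness[OF assms(1)] have "A \<subseteq> connection {}" by (metis card_0_eq)
  then show "A = {}" using assms(2) by (auto simp: connection_def irrefl_def)
qed simp

lemma rank_image_le:
  assumes "finite A"
  shows "rank (map_prod h h ` A) \<le> rank A"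
proof -
  obtain B where B: "B \<subseteq> A" "finite B" "A \<subseteq> connection B" "card B = rank A"
    using rank_witness[OF assms] .
  have "rank (map_prod h h ` A) \<le> card (map_prod h h ` B)"
    using B by (intro rank_le) (auto intro: connection_image)
  also have "\<dots> \<le> card B" using B by (intro card_image_le)
  finally show ?thesis using B by simp
qed

lemma rank_image:
  assumes "finite A" "inj_on h (Field A)"
  shows "rank (map_prod h h ` A) = rank A"
proof (rule antisym)
  let ?g = "the_inv_into (Field A) h"
  have "map_prod ?g ?g ` (map_prod h h ` A) = A"
    using assms(2) by (force simp: image_iff the_inv_into_f_f FieldI1 FieldI2)
  then show "rank A \<le> rank (map_prod h h ` A)"
    using rank_image_le[of "map_prod h h ` A" ?g] assms(1) by simp
qed (rule rank_image_le[OF assms(1)])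

text \<open>
  A walk that starts in one of two vertex-disjoint parts can never leave it.
\<close>

lemma connection_restrict:
  assumes "(x, y) \<in> connection B" "x \<in> Field A" "B \<subseteq> A \<union> A'" "Field A \<inter> Field A' = {}"
  shows "y \<in> Field A \<and> (x, y) \<in> connection (B \<inter> A)"
  using assms(1) unfolding connection_def
proof (induction rule: rtrancl_induct)
  case (step y z)
  then have "(y, z) \<in> (B \<inter> A) \<union> (B \<inter> A)\<inverse>"
    using assms(3,4) by (auto simp: Field_def)
  moreover from this have "z \<in> Field A" by (auto simp: Field_def)
  ultimately show ?case using step.IH by (meson rtrancl.rtrancl_into_rtrancl)
qed (use assms(2) in simp)

lemma rank_Un_disjoint:
  assumes "finite A" "finite A'" "Field A \<inter> Field A' = {}"
  shows "rank (A \<union> A') = rank A + rank A'"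
proof (rule antisym)
  obtain B where B: "B \<subseteq> A \<union> A'" "finite B" "A \<union> A' \<subseteq> connection B" "card B = rank (A \<union> A')"
    using rank_witness[of "A \<union> A'"] assms by auto
  have disj: "A \<inter> A' = {}" using assms(3) by (auto simp: Field_def)
  have "A \<subseteq> connection (B \<inter> A)" "A' \<subseteq> connection (B \<inter> A')"
    using B(3) connection_restrict[OF _ FieldI1 B(1) assms(3)]
      connection_restrict[OF _ FieldI1 B(1)[unfolded Un_commute[of A]] assms(3)[unfolded Int_commute[of "Field A"]]]
    by auto
  then have "rank A \<le> card (B \<inter> A)" "rank A' \<le> card (B \<inter> A')"
    using B by (auto intro!: rank_le)
  moreover have "card (B \<inter> A) + card (B \<inter> A') = card B"
  proof -
    have "B = (B \<inter> A) \<union> (B \<inter> A')" using B(1) by auto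
    then show ?thesis
      using B(2) disj card_Un_disjoint[of "B \<inter> A" "B \<inter> A'"] by (simp add: Int_Un_distrib disjoint_iff)
  qed
  ultimately show "rank A + rank A' \<le> rank (A \<union> A')" using B by simp
qed (rule rank_Un_le[OF assms(1,2)])

section \<open>Whitney's expansion of the chromatic polynomial\<close>

lemma finite_parcs: "pair_graph G \<Longrightarrow> finite (parcs G)"
  unfolding pair_graph_iff by (meson finite_SigmaI finite_subset)

text \<open>
  For \<open>c\<close> the number of components of \<open>(V, A)\<close>, this set has \<open>n ^ c\<close> elements.
\<close>

definition constant_colorings :: "'a set \<Rightarrow> 'a rel \<Rightarrow> nat \<Rightarrow> ('a \<Rightarrow> nat) set" where
  "constant_colorings V A n = {c \<in> V \<rightarrow>\<^sub>E {..<n}. \<forall>(u, v) \<in> A. c u = c v}"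

lemma finite_constant_colorings: "finite V \<Longrightarrow> finite (constant_colorings V A n)"
  unfolding constant_colorings_def by (simp add: finite_PiE)

lemma constant_colorings_cong:
  assumes "B \<subseteq> A" "A \<subseteq> connection B"
  shows "constant_colorings V A n = constant_colorings V B n"
  using assms connection_const[of _ _ B] unfolding constant_colorings_def by blast

text \<open>
  If \<open>v\<close> is not in the component \<open>C\<close> of \<open>u\<close>, exchanging the colors \<open>i\<close> and \<open>j\<close> on \<open>C\<close> turns a coloring with
  colors \<open>i, j\<close> at \<open>u, v\<close> into one with color \<open>j\<close> at both. Therefore each of the \<open>n\<close> colors is equally
  likely at \<open>u\<close> once the color at \<open>v\<close> is known, and demanding equality divides the count by \<open>n\<close>.
\<close>

lemma card_constant_colorings_insert:
  assumes V: "finite V" and uv: "u \<in> V" "v \<in> V" and new: "(u, v) \<notin> connection B"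
    and B: "B \<subseteq> V \<times> V"
  shows "card (constant_colorings V B n) = n * card (constant_colorings V (insert (u, v) B) n)"
proof -
  define X where "X i j = {c \<in> constant_colorings V B n. c u = i \<and> c v = j}" for i j
  define C where "C = {x \<in> V. (u, x) \<in> connection B}"
  define f where "f i j c = (\<lambda>x. if x \<in> C then Transposition.transpose i j (c x) else c x)"
    for i j and c :: "'a \<Rightarrow> nat"
  have uvC: "u \<in> C" "v \<notin> C" using uv new by (auto simp: C_def)
  have CB: "x \<in> C \<longleftrightarrow> y \<in> C" if "(x, y) \<in> B" for x y
  proof -
    have "(x, y) \<in> connection B" using that subset_connection[of B] by blast
    then have "(u, x) \<in> connection B \<longleftrightarrow> (u, y) \<in> connection B"
      by (meson connection_sym connection_trans)
    then show ?thesis using that B by (auto simp: C_def)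
  qed
  have inv: "f i j (f i j c) = c" for i j c by (auto simp: f_def)
  have maps: "f i j c \<in> X a' b" if "i < n" "j < n" "c \<in> X a b" "a' = Transposition.transpose i j a"
    for i j a a' b c
  proof -
    have c: "c \<in> V \<rightarrow>\<^sub>E {..<n}" "\<forall>(u, v) \<in> B. c u = c v" "c u = a" "c v = b"
      using that by (auto simp: X_def constant_colorings_def)
    have "f i j c \<in> V \<rightarrow>\<^sub>E {..<n}"
      using c(1) that by (auto simp: f_def C_def PiE_iff extensional_def Transposition.transpose_def)
    then show ?thesis
      using c uvC CB that(4) by (force simp: X_def constant_colorings_def f_def)
  qed
  have swap: "card (X i j) = card (X j j)" if "i < n" "j < n" for i j
  proof (rule bij_betw_same_card[of "f i j"], rule bij_betw_byWitness[where f' = "f i j"])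
    show "f i j ` X i j \<subseteq> X j j" "f i j ` X j j \<subseteq> X i j" 
      using maps[OF that, where a = i and a' = j and b = j]
        maps[OF that, where a = j and a' = i and b = j] by auto
  qed (auto simp: inv)
  have fin: "finite (X i j)" for i j
    using finite_constant_colorings[OF V] by (simp add: X_def)
  have "constant_colorings V B n = (\<Union>P\<in>{..<n} \<times> {..<n}. X (fst P) (snd P))"
    using uv by (auto simp: X_def constant_colorings_def)
  also have "card \<dots> = (\<Sum>P\<in>{..<n} \<times> {..<n}. card (X (fst P) (snd P)))"
    by (rule card_UN_disjoint) (use fin in \<open>auto simp: X_def\<close>)
  also have "\<dots> = (\<Sum>i<n. \<Sum>j<n. card (X i j))"
    by (subst sum.cartesian_product) (simp only: case_prod_unfold)
  also have "\<dots> = (\<Sum>i<n. \<Sum>j<n. card (X j j))" by (intro sum.cong refl swap) auto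
  also have "\<dots> = n * (\<Sum>j<n. card (X j j))" by simp
  also have "(\<Sum>j<n. card (X j j)) = card (\<Union>j<n. X j j)"
    by (rule card_UN_disjoint[symmetric]) (use fin in \<open>auto simp: X_def\<close>)
  also have "(\<Union>j<n. X j j) = constant_colorings V (insert (u, v) B) n"
    using uv by (auto simp: X_def constant_colorings_def)
  finally show ?thesis .
qed

lemma card_constant_colorings_independent:
  assumes "finite V" "finite B" "B \<subseteq> V \<times> V" "\<And>e. e \<in> B \<Longrightarrow> e \<notin> connection (B - {e})"
  shows "card (constant_colorings V B n) * n ^ card B = n ^ card V"
  using assms(2-)
proof (induction B rule: finite_induct)
  case empty
  show ?case using assms(1) by (simp add: constant_colorings_def card_PiE)
next
  case (insert e B)
  obtain u v where e: "e = (u, v)" by (cases e)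
  have "e' \<notin> connection (B - {e'})" if "e' \<in> B" for e'
    using insert.prems(2)[of e'] that connection_mono[of "B - {e'}" "insert e B - {e'}"] by auto
  then have IH: "card (constant_colorings V B n) * n ^ card B = n ^ card V"
    using insert by blast
  have "e \<notin> connection B" using insert.prems(2)[of e] insert.hyps by simp
  then have "card (constant_colorings V B n) = n * card (constant_colorings V (insert e B) n)"
    using insert.prems(1) assms(1) unfolding e by (intro card_constant_colorings_insert) auto
  then show ?case using IH insert.hyps by (simp add: ac_simps)
qed

text \<open>
  A smallest connecting subset \<open>B\<close> of \<open>A\<close> is independent: an edge already connected by the others
  could be dropped. The product form avoids dividing by \<open>n\<close>, which may be zero.
\<close>

lemma card_constant_colorings:
  assumes V: "finite V" and A: "A \<subseteq> V \<times> V"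
  shows "card (constant_colorings V A n) * n ^ rank A = n ^ card V"
proof -
  have "finite A" using V A finite_subset by blast
  then obtain B where B: "B \<subseteq> A" "finite B" "A \<subseteq> connection B" "card B = rank A"
    using rank_witness by blast
  have "e \<notin> connection (B - {e})" if e: "e \<in> B" for e
  proof
    assume "e \<in> connection (B - {e})"
    then have "B \<subseteq> connection (B - {e})" using subset_connection[of "B - {e}"] by auto
    then have "A \<subseteq> connection (B - {e})" using B(3) connection_subset by blast
    then have "rank A \<le> card (B - {e})" using B by (intro rank_le) auto
    then show False using B(2,4) e by (metis card_Diff1_less leD)
  qed
  then have "card (constant_colorings V B n) * n ^ card B = n ^ card V"
    using V A B by (intro card_constant_colorings_independent) auto
  then show ?thesis using B constant_colorings_cong[of B A V n] by simp
qed

text \<open>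
  Taking \<open>n = 2\<close> in the count shows that \<open>2 ^ rank A\<close> divides \<open>2 ^ card V\<close>.
\<close>

lemma rank_le_card:
  assumes "finite V" "A \<subseteq> V \<times> V"
  shows "rank A \<le> card V"
proof -
  have "(2::nat) ^ rank A dvd 2 ^ card V"
    using card_constant_colorings[OF assms, of 2] by (metis dvd_triv_right)
  then show ?thesis by (simp add: dvd_power_iff_le)
qed

text \<open>
  Inclusion-exclusion: the indicator of properness is the product over all edges of
  \<open>1 - [c u = c v]\<close>, which expands into a sum over edge sets.
\<close>

lemma card_proper_colorings_alternating:
  assumes "pair_graph G"
  shows "(of_nat (card (proper_colorings G n)) :: 'a::comm_ring_1) =
    (\<Sum>A\<in>Pow (parcs G). (-1) ^ card A * of_nat (card (constant_colorings (pverts G) A n)))"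
proof -
  let ?V = "pverts G" and ?E = "parcs G"
  let ?F = "?V \<rightarrow>\<^sub>E {..<n}"
  let ?eq = "\<lambda>c (u, v). of_bool (c u = c v) :: 'a"
  have fV: "finite ?V" and fE: "finite ?E"
    using assms finite_parcs[OF assms] by (auto simp: pair_graph_iff)
  have fF: "finite ?F" using fV by (simp add: finite_PiE)
  have prod_bool: "(\<Prod>x\<in>X. of_bool (P x)) = (of_bool (\<forall>x\<in>X. P x) :: 'a)" if "finite X"
    for P and X :: "('b \<times> 'b) set"
    using that by induction auto
  have ind: "(\<Prod>e\<in>A. ?eq c e) = of_bool (\<forall>(u, v)\<in>A. c u = c v)" if "A \<subseteq> ?E" for A and c :: "_ \<Rightarrow> nat"
    using prod_bool[OF finite_subset[OF that fE], of "\<lambda>(u, v). c u = c v"]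
    by (simp only: case_prod_unfold)
  have "(of_nat (card (proper_colorings G n)) :: 'a) = (\<Sum>c\<in>?F. of_bool (\<forall>(u, v)\<in>?E. c u \<noteq> c v))"
    using fF by (simp add: proper_colorings_def of_bool_def sum.If_cases Int_def)
  also have "\<dots> = (\<Sum>c\<in>?F. \<Prod>e\<in>?E. 1 - ?eq c e)"
  proof (intro sum.cong refl)
    fix c :: "_ \<Rightarrow> nat"
    show "of_bool (\<forall>(u, v)\<in>?E. c u \<noteq> c v) = (\<Prod>e\<in>?E. 1 - ?eq c e)"
      using prod_bool[OF fE, of "\<lambda>(u, v). c u \<noteq> c v"]
      by (simp add: case_prod_unfold of_bool_not_iff)
  qed
  also have "\<dots> = (\<Sum>c\<in>?F. \<Sum>A\<in>Pow ?E. (-1) ^ card A * of_bool (\<forall>(u, v)\<in>A. c u = c v))"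
    using fE by (subst prod_diff_conv_sum) (auto intro!: sum.cong simp: ind)
  also have "\<dots> = (\<Sum>A\<in>Pow ?E. (-1) ^ card A * (\<Sum>c\<in>?F. of_bool (\<forall>(u, v)\<in>A. c u = c v)))"
    by (subst sum.swap) (simp add: sum_distrib_left)
  also have "\<dots> = (\<Sum>A\<in>Pow ?E. (-1) ^ card A * of_nat (card (constant_colorings ?V A n)))"
    using fF by (simp add: constant_colorings_def of_bool_def sum.If_cases Int_def)
  finally show ?thesis .
qed

lemma whitney_expansion:
  assumes G: "pair_graph G"
  shows "chromatic_poly G =
    (\<Sum>A\<in>Pow (parcs G). monom ((-1) ^ card A) (card (pverts G) - rank A))"
    (is "_ = ?W")
proof -
  let ?V = "pverts G"
  have V: "finite ?V" and E: "parcs G \<subseteq> ?V \<times> ?V" using G by (auto simp: pair_graph_iff)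
  have "poly (chromatic_poly G) (of_nat n) = poly ?W (of_nat n)" if n: "n > 0" for n
  proof -
    have count: "of_nat (card (constant_colorings ?V A n)) = (of_nat n :: rat) ^ (card ?V - rank A)"
      if "A \<subseteq> parcs G" for A
    proof -
      have A: "A \<subseteq> ?V \<times> ?V" using that E by blast
      have "(of_nat n :: rat) ^ (card ?V - rank A) * of_nat n ^ rank A = of_nat n ^ card ?V"
        using rank_le_card[OF V A] by (simp flip: power_add)
      also have "\<dots> = of_nat (card (constant_colorings ?V A n)) * of_nat n ^ rank A"
        using card_constant_colorings[OF V A, of n] by (metis of_nat_mult of_nat_power)
      finally show ?thesis using n by simp
    qed
    show ?thesis
      unfolding poly_chromatic_poly[OF G] card_proper_colorings_alternating[OF G] poly_sum
      by (rule sum.cong) (simp_all add: poly_monom count)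
  qed
  \<comment> \<open>The count determines both polynomials at positive \<open>n\<close> only; multiplying by the indeterminate makes
    them agree at \<open>0\<close> as well.\<close>
  then have "poly (pCons 0 (chromatic_poly G)) (of_nat n) = poly (pCons 0 ?W) (of_nat n)" for n
    by (cases "n = 0") simp_all
  then have "pCons 0 (chromatic_poly G) = pCons 0 ?W" by (rule poly_eqI_of_nat)
  then show ?thesis by simp
qed

section \<open>The rank generating series and its logarithmic derivative\<close>

definition whitney_series :: "'a rel \<Rightarrow> rat fps" where
  "whitney_series E = (\<Sum>A\<in>Pow E. fps_const ((-1) ^ card A) * fps_X ^ rank A)"

lemma whitney_series_nth:
  "whitney_series E $ r = (\<Sum>A\<in>Pow E. if rank A = r then (-1) ^ card A else 0)"
  unfolding whitney_series_def by (simp add: fps_sum_nth if_distrib eq_commute[of r] cong: if_cong)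

lemma whitney_series_nth_0:
  assumes "finite E" "irrefl E"
  shows "whitney_series E $ 0 = 1"
proof -
  have "rank A = 0 \<longleftrightarrow> A = {}" if "A \<in> Pow E" for A
    using that assms finite_subset by (intro rank_eq_0_iff) (auto simp: irrefl_def)
  then have "whitney_series E $ 0 = (\<Sum>A\<in>Pow E. if A = {} then 1 else 0)"
    unfolding whitney_series_nth by (intro sum.cong) auto
  then show ?thesis using assms by simp
qed

lemma whitney_series_empty [simp]: "whitney_series {} = 1"
  by (simp add: whitney_series_def)

text \<open>
  An edge set inside a vertex-disjoint union splits uniquely into its two traces, and both its size and
  its rank are additive.
\<close>

lemma whitney_series_Un:
  assumes fin: "finite E" "finite E'" and disj: "Field E \<inter> Field E' = {}"
  shows "whitney_series (E \<union> E') = whitney_series E * whitney_series E'"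
proof -
  let ?t = "\<lambda>A :: 'a rel. fps_const ((-1) ^ card A) * fps_X ^ rank A :: rat fps"
  have EE': "E \<inter> E' = {}" using disj by (auto simp: Field_def)
  have "whitney_series E * whitney_series E' = (\<Sum>(A, A')\<in>Pow E \<times> Pow E'. ?t A * ?t A')"
    unfolding whitney_series_def sum_product by (rule sum.cartesian_product)
  also have "\<dots> = (\<Sum>A\<in>Pow (E \<union> E'). ?t A)"
  proof (rule sum.reindex_bij_witness[where i = "\<lambda>A. (A \<inter> E, A \<inter> E')" and j = "\<lambda>(A, A'). A \<union> A'"])
    fix P assume "P \<in> Pow E \<times> Pow E'"
    then obtain A A' where P: "P = (A, A')" "A \<subseteq> E" "A' \<subseteq> E'" by auto
    then have f: "finite A" "finite A'" using fin finite_subset by auto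
    have "rank (A \<union> A') = rank A + rank A'"
      using P f disj mono_Field[of A E] mono_Field[of A' E'] by (intro rank_Un_disjoint) auto
    moreover have "card (A \<union> A') = card A + card A'"
      using P f EE' by (intro card_Un_disjoint) auto
    ultimately show "?t (case P of (A, A') \<Rightarrow> A \<union> A') = (case P of (A, A') \<Rightarrow> ?t A * ?t A')"
      using P by (simp add: power_add algebra_simps flip: fps_const_mult)
  qed (use EE' in auto)
  finally show ?thesis by (simp add: whitney_series_def)
qed

lemma whitney_series_image:
  assumes "finite E" "inj_on h (Field E)"
  shows "whitney_series (map_prod h h ` E) = whitney_series E"
proof -
  have inj: "inj_on (map_prod h h) E"
  proof (rule inj_onI, clarsimp)
    fix a b c d assume "(a, b) \<in> E" "(c, d) \<in> E" "h a = h c" "h b = h d"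
    then show "a = c \<and> b = d"
      using assms(2) by (meson inj_onD FieldI1 FieldI2)
  qed
  have "inj_on h (Field A)" if "A \<subseteq> E" for A
    using that assms(2) mono_Field[of A E] by (auto intro: inj_on_subset)
  then have "rank (map_prod h h ` A) = rank A \<and> card (map_prod h h ` A) = card A" if "A \<subseteq> E" for A
    using that inj assms(1) by (auto intro!: rank_image card_image intro: finite_subset inj_on_subset)
  moreover have "Pow (map_prod h h ` E) = (`) (map_prod h h) ` Pow E"
    by (rule image_Pow_surj[symmetric]) (rule refl)
  ultimately show ?thesis
    unfolding whitney_series_def using inj_on_image_Pow[OF inj] by (simp add: sum.reindex)
qed

text \<open>
  The operator \<open>Z \<mapsto> t Z' / Z\<close> has the virtue of the logarithm that matters here, turning products into
  sums, and its coefficients are related to those of \<open>Z\<close> by a finite recursion.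
\<close>

definition log_deriv_series :: "'a rel \<Rightarrow> rat fps" where
  "log_deriv_series E = fps_X * fps_deriv (whitney_series E) * inverse (whitney_series E)"

lemma log_deriv_series_empty [simp]: "log_deriv_series {} = 0"
  by (simp add: log_deriv_series_def)

lemma log_deriv_series_nth_0 [simp]: "log_deriv_series E $ 0 = 0"
  by (simp add: log_deriv_series_def)

lemma log_deriv_series_Un:
  assumes "finite E" "finite E'" "irrefl E" "irrefl E'" "Field E \<inter> Field E' = {}"
  shows "log_deriv_series (E \<union> E') = log_deriv_series E + log_deriv_series E'"
proof -
  let ?Z = "whitney_series E" and ?Z' = "whitney_series E'"
  have inv: "?Z * inverse ?Z = 1" "?Z' * inverse ?Z' = 1"
    using whitney_series_nth_0[OF assms(1,3)] whitney_series_nth_0[OF assms(2,4)]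
    by (auto intro: inverse_mult_eq_1')
  have "log_deriv_series (E \<union> E') =
      fps_X * fps_deriv ?Z * inverse ?Z * (?Z' * inverse ?Z') +
      fps_X * fps_deriv ?Z' * inverse ?Z' * (?Z * inverse ?Z)"
    unfolding log_deriv_series_def whitney_series_Un[OF assms(1,2,5)]
    by (simp add: fps_inverse_mult algebra_simps)
  then show ?thesis by (simp add: inv log_deriv_series_def)
qed

lemma log_deriv_series_image:
  assumes "finite E" "inj_on h (Field E)"
  shows "log_deriv_series (map_prod h h ` E) = log_deriv_series E"
  unfolding log_deriv_series_def by (simp add: whitney_series_image[OF assms])

text \<open>
  Coefficient comparison in \<open>M Z = t Z'\<close>, with the term \<open>M\<^sub>r Z\<^sub>0 = M\<^sub>r\<close> singled out. It is used in both
  directions: to show that \<open>M\<^sub>r\<close> is local, and to recover \<open>Z\<^sub>r\<close> from \<open>M\<^sub>1, \<dots>, M\<^sub>r\<close>.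
\<close>

lemma newton_identity:
  assumes "finite E" "irrefl E" "r > 0"
  shows "of_nat r * whitney_series E $ r =
    log_deriv_series E $ r + (\<Sum>i=1..<r. log_deriv_series E $ i * whitney_series E $ (r - i))"
proof -
  let ?Z = "whitney_series E" and ?M = "log_deriv_series E"
  have Z0: "?Z $ 0 = 1" by (rule whitney_series_nth_0[OF assms(1,2)])
  have "?M * ?Z = fps_X * fps_deriv ?Z * (inverse ?Z * ?Z)"
    by (simp add: log_deriv_series_def mult.assoc)
  also have "\<dots> = fps_X * fps_deriv ?Z" using Z0 by (subst inverse_mult_eq_1) auto
  finally have "(?M * ?Z) $ r = of_nat r * ?Z $ r" using assms(3) by simp
  then have "of_nat r * ?Z $ r = (\<Sum>i=0..r. ?M $ i * ?Z $ (r - i))" by (simp add: fps_mult_nth)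
  also have "\<dots> = (\<Sum>i\<in>insert r {1..<r}. ?M $ i * ?Z $ (r - i))"
  proof (rule sum.mono_neutral_right)
    show "\<forall>i\<in>{0..r} - insert r {1..<r}. ?M $ i * ?Z $ (r - i) = 0"
    proof
      fix i assume "i \<in> {0..r} - insert r {1..<r}"
      then have "i = 0" by auto
      then show "?M $ i * ?Z $ (r - i) = 0" by simp
    qed
  qed (use assms(3) in auto)
  finally show ?thesis using Z0 by simp
qed

lemma coeff_chromatic_poly:
  assumes G: "pair_graph G" and r: "r \<le> card (pverts G)"
  shows "coeff (chromatic_poly G) (card (pverts G) - r) = whitney_series (parcs G) $ r"
proof -
  have "card (pverts G) - rank A = card (pverts G) - r \<longleftrightarrow> rank A = r" if "A \<subseteq> parcs G" for A
  proof -
    have "rank A \<le> card (pverts G)" using G that by (intro rank_le_card) (auto simp: pair_graph_iff)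
    then show ?thesis using r by auto
  qed
  then show ?thesis
    unfolding whitney_expansion[OF G] coeff_sum whitney_series_nth
    by (intro sum.cong) (simp_all add: coeff_monom)
qed

lemma degree_chromatic_poly:
  assumes G: "pair_graph G"
  shows "degree (chromatic_poly G) = card (pverts G)" "chromatic_poly G \<noteq> 0"
proof -
  have "finite (parcs G)" "irrefl (parcs G)"
    using G finite_parcs[OF G] by (auto simp: pair_graph_iff)
  then have lead: "coeff (chromatic_poly G) (card (pverts G)) = 1"
    using coeff_chromatic_poly[OF G, of 0] by (simp add: whitney_series_nth_0)
  then show "chromatic_poly G \<noteq> 0" by auto
  have "degree (chromatic_poly G) \<le> card (pverts G)"
    unfolding whitney_expansion[OF G] using \<open>finite (parcs G)\<close>
    by (intro degree_sum_le) (auto intro: order_trans[OF degree_monom_le])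
  then show "degree (chromatic_poly G) = card (pverts G)"
    using lead le_degree[of "chromatic_poly G" "card (pverts G)"] by auto
qed

section \<open>Local decomposition of the logarithmic derivative\<close>

text \<open>
  Every function of finite edge sets is a sum of weights over subsets, by Moebius inversion; locality of
  degree \<open>d\<close> demands that only subsets of rank at most \<open>d\<close> contribute. Loops are excluded because they
  have rank \<open>0\<close> and would spoil \<open>Z\<^sub>0 = 1\<close>.
\<close>

definition rank_local :: "nat \<Rightarrow> ('a rel \<Rightarrow> rat) \<Rightarrow> bool" where
  "rank_local d F \<longleftrightarrow> (\<exists>w. (\<forall>H. finite H \<and> d < rank H \<longrightarrow> w H = 0) \<and>
     (\<forall>E. finite E \<and> irrefl E \<longrightarrow> F E = (\<Sum>H\<in>Pow E. w H)))"

lemma rank_localE: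
  assumes "rank_local d F"
  obtains w where "\<And>H. finite H \<Longrightarrow> d < rank H \<Longrightarrow> w H = 0"
    and "\<And>E. finite E \<Longrightarrow> irrefl E \<Longrightarrow> F E = (\<Sum>H\<in>Pow E. w H)"
  using assms unfolding rank_local_def by (elim exE conjE, intro that) simp_all

lemma rank_local_cong:
  assumes "rank_local d F" "\<And>E. finite E \<Longrightarrow> irrefl E \<Longrightarrow> F' E = F E"
  shows "rank_local d F'"
  using assms unfolding rank_local_def by auto

lemma rank_local_diff:
  assumes "rank_local d F" "rank_local d F'"
  shows "rank_local d (\<lambda>E. F E - F' E)"
proof -
  obtain w where w: "\<And>H. finite H \<Longrightarrow> d < rank H \<Longrightarrow> w H = 0"
    "\<And>E. finite E \<Longrightarrow> irrefl E \<Longrightarrow> F E = (\<Sum>H\<in>Pow E. w H)"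
    using rank_localE[OF assms(1)] by blast
  obtain w' where w': "\<And>H. finite H \<Longrightarrow> d < rank H \<Longrightarrow> w' H = 0"
    "\<And>E. finite E \<Longrightarrow> irrefl E \<Longrightarrow> F' E = (\<Sum>H\<in>Pow E. w' H)"
    using rank_localE[OF assms(2)] by blast
  from w w' show ?thesis
    unfolding rank_local_def by (intro exI[of _ "\<lambda>H. w H - w' H"]) (auto simp: sum_subtractf)
qed

lemma rank_local_zero: "rank_local d (\<lambda>E. 0)"
  unfolding rank_local_def by (intro exI[of _ "\<lambda>_. 0"]) auto

lemma rank_local_scale:
  assumes "rank_local d F"
  shows "rank_local d (\<lambda>E. a * F E)"
proof -
  obtain w where w: "\<And>H. finite H \<Longrightarrow> d < rank H \<Longrightarrow> w H = 0"
    "\<And>E. finite E \<Longrightarrow> irrefl E \<Longrightarrow> F E = (\<Sum>H\<in>Pow E. w H)"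
    using rank_localE[OF assms] by blast
  then show ?thesis
    unfolding rank_local_def by (intro exI[of _ "\<lambda>H. a * w H"]) (auto simp: sum_distrib_left)
qed

lemma rank_local_sum:
  assumes "\<And>i. i \<in> I \<Longrightarrow> rank_local d (F i)"
  shows "rank_local d (\<lambda>E. \<Sum>i\<in>I. F i E)"
  using assms
proof (induction I rule: infinite_finite_induct)
  case (insert i I)
  have "rank_local d (\<lambda>E. F i E - (-1) * (\<Sum>i\<in>I. F i E))"
    using insert by (intro rank_local_diff rank_local_scale) auto
  with insert.hyps show ?case by simp
qed (auto simp: rank_local_zero)

text \<open>
  The weight of \<open>H\<close> in the product collects all ways of writing \<open>H = A \<union> A'\<close>; since the rank is
  subadditive, one of the two factors vanishes when \<open>rank H > d + d'\<close>.
\<close>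

lemma rank_local_mult:
  assumes "rank_local d F" "rank_local d' F'"
  shows "rank_local (d + d') (\<lambda>E. F E * F' E)"
proof -
  obtain w where w: "\<And>H. finite H \<Longrightarrow> d < rank H \<Longrightarrow> w H = 0"
    "\<And>E. finite E \<Longrightarrow> irrefl E \<Longrightarrow> F E = (\<Sum>H\<in>Pow E. w H)"
    using rank_localE[OF assms(1)] by blast
  obtain w' where w': "\<And>H. finite H \<Longrightarrow> d' < rank H \<Longrightarrow> w' H = 0"
    "\<And>E. finite E \<Longrightarrow> irrefl E \<Longrightarrow> F' E = (\<Sum>H\<in>Pow E. w' H)"
    using rank_localE[OF assms(2)] by blast
  define W where "W H = (\<Sum>(A, A') | A \<subseteq> H \<and> A' \<subseteq> H \<and> A \<union> A' = H. w A * w' A')" for H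
  have "W H = 0" if H: "finite H" "d + d' < rank H" for H
    unfolding W_def
  proof (rule sum.neutral, safe)
    fix A A' assume A: "A \<subseteq> A \<union> A'" "A' \<subseteq> A \<union> A'" "H = A \<union> A'"
    then have fin: "finite A" "finite A'" using H by auto
    then have "d < rank A \<or> d' < rank A'" using H(2) A rank_Un_le[OF fin] by auto
    then show "w A * w' A' = 0" using w(1) w'(1) fin by auto
  qed
  moreover have "F E * F' E = (\<Sum>H\<in>Pow E. W H)" if E: "finite E" "irrefl E" for E
  proof -
    have "F E * F' E = (\<Sum>P\<in>Pow E \<times> Pow E. w (fst P) * w' (snd P))"
      unfolding w(2)[OF E] w'(2)[OF E] sum_product sum.cartesian_product case_prod_unfold ..
    also have "\<dots> = (\<Sum>H\<in>Pow E. \<Sum>P\<in>{P \<in> Pow E \<times> Pow E. fst P \<union> snd P = H}. w (fst P) * w' (snd P))"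
      using E(1) by (intro sum.group[symmetric]) auto
    also have "\<dots> = (\<Sum>H\<in>Pow E. W H)"
      unfolding W_def case_prod_unfold by (intro sum.cong) auto
    finally show ?thesis .
  qed
  ultimately show ?thesis unfolding rank_local_def by blast
qed

lemma rank_local_whitney_series: "rank_local r (\<lambda>E. whitney_series E $ r)"
  unfolding rank_local_def whitney_series_nth
  by (intro exI[of _ "\<lambda>A. if rank A = r then (-1) ^ card A else 0"]) auto

lemma rank_local_log_deriv_series: "rank_local r (\<lambda>E :: 'a rel. log_deriv_series E $ r)"
proof (induction r rule: less_induct)
  case (less r)
  show ?case
  proof (cases "r = 0")
    case True
    then show ?thesis by (simp add: rank_local_zero)
  next
    case False
    have "rank_local r (\<lambda>E :: 'a rel. log_deriv_series E $ i * whitney_series E $ (r - i))" if "i \<in> {1..<r}" for i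
      using rank_local_mult[OF less.IH[of i] rank_local_whitney_series[of "r - i"]] that by simp
    then have "rank_local r (\<lambda>E :: 'a rel. of_nat r * whitney_series E $ r -
        (\<Sum>i=1..<r. log_deriv_series E $ i * whitney_series E $ (r - i)))"
      by (intro rank_local_diff rank_local_sum rank_local_scale rank_local_whitney_series)
    then show ?thesis
      by (rule rank_local_cong) (use False in \<open>simp add: newton_identity\<close>)
  qed
qed

text \<open>
  Disconnected as a graph without isolated vertices: only the endpoints of edges count.
\<close>

definition vertex_disconnected :: "'a rel \<Rightarrow> bool" where
  "vertex_disconnected H \<longleftrightarrow>
     (\<exists>A B. H = A \<union> B \<and> A \<noteq> {} \<and> B \<noteq> {} \<and> Field A \<inter> Field B = {})"

text \<open>
  The value of \<open>F\<close> at \<open>H = A \<union> B\<close> is exhausted by the subsets of \<open>A\<close> and those of \<open>B\<close>, so the weights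
  of the subsets meeting both parts sum to zero. All of these are disconnected, and by induction all but
  \<open>H\<close> itself have weight zero.
\<close>

lemma weight_disconnected:
  fixes F w :: "'a rel \<Rightarrow> rat"
  assumes sum: "\<And>E. finite E \<Longrightarrow> irrefl E \<Longrightarrow> F E = (\<Sum>H\<in>Pow E. w H)"
    and add: "\<And>A B. finite A \<Longrightarrow> finite B \<Longrightarrow> irrefl A \<Longrightarrow> irrefl B \<Longrightarrow>
       Field A \<inter> Field B = {} \<Longrightarrow> F (A \<union> B) = F A + F B"
    and H: "finite H" "irrefl H" "vertex_disconnected H"
  shows "w H = 0"
  using H
proof (induction H rule: finite_psubset_induct)
  case (psubset H)
  obtain A B where AB: "H = A \<union> B" "A \<noteq> {}" "B \<noteq> {}" "Field A \<inter> Field B = {}"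
    using psubset.prems(2) unfolding vertex_disconnected_def by blast
  have irr: "irrefl C" if "C \<subseteq> H" for C using that psubset.prems(1) by (auto simp: irrefl_def)
  have fin: "finite A" "finite B" using psubset.hyps AB by auto
  have disj: "A \<inter> B = {}" using AB(4) by (auto simp: Field_def)
  have "F {} = F {} + F {}" using add[of "{}" "{}"] by (simp add: irrefl_def)
  then have w0: "w {} = 0" using sum[of "{}"] by (simp add: irrefl_def)
  let ?R = "Pow H - (Pow A \<union> Pow B)"
  have "w C = 0" if C: "C \<in> ?R - {H}" for C
  proof (rule psubset.IH)
    have "C = (C \<inter> A) \<union> (C \<inter> B)" "C \<inter> A \<noteq> {}" "C \<inter> B \<noteq> {}" using C AB by auto
    moreover have "Field (C \<inter> A) \<inter> Field (C \<inter> B) = {}"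
      using AB(4) mono_Field[of "C \<inter> A" A] mono_Field[of "C \<inter> B" B] by auto
    ultimately show "vertex_disconnected C" unfolding vertex_disconnected_def by blast
  qed (use C irr in auto)
  moreover have "H \<in> ?R" using AB disj by auto
  ultimately have R: "sum w ?R = w H"
    using psubset.hyps sum.remove[of ?R H w] by simp
  have "sum w (Pow H) = sum w ?R + sum w (Pow A \<union> Pow B)"
    using psubset.hyps AB(1) by (intro sum.subset_diff) auto
  also have "sum w (Pow A \<union> Pow B) = sum w (Pow A) + sum w (Pow B) - sum w (Pow A \<inter> Pow B)"
    using fin by (intro sum_Un) auto
  also have "Pow A \<inter> Pow B = {{}}" using disj by auto
  finally have "F H = w H + F A + F B"
    using R w0 sum irr fin psubset.hyps AB(1) by simp
  moreover have "F H = F A + F B"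
    unfolding AB(1) using AB irr fin by (intro add) auto
  ultimately show ?case by simp
qed

text \<open>
  The weights are determined recursively by \<open>F\<close>, so every symmetry of \<open>F\<close> is a symmetry of the weights.
\<close>

lemma weight_image:
  fixes F w :: "'a rel \<Rightarrow> rat"
  assumes sum: "\<And>E. finite E \<Longrightarrow> irrefl E \<Longrightarrow> F E = (\<Sum>H\<in>Pow E. w H)"
    and inv: "\<And>E. finite E \<Longrightarrow> F (map_prod h h ` E) = F E"
    and h: "inj h" and H: "finite H" "irrefl H"
  shows "w (map_prod h h ` H) = w H"
  using H
proof (induction H rule: finite_psubset_induct)
  case (psubset H)
  let ?h = "map_prod h h"
  have inj: "inj ?h" using h by (simp add: prod.inj_map)
  have IH: "w (?h ` C) = w C" if "C \<in> Pow H - {H}" for C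
    using that psubset by (auto simp: irrefl_def)
  have irr: "irrefl (?h ` H)" using psubset.prems h by (auto simp: irrefl_def dest: injD)
  have inj_Pow: "inj_on ((`) ?h) (Pow H)" 
    using inj by (intro inj_on_image_Pow inj_on_subset[OF inj]) simp
  have "(\<Sum>C\<in>Pow H. w (?h ` C)) = (\<Sum>C\<in>(`) ?h ` Pow H. w C)"
    by (simp add: sum.reindex[OF inj_Pow])
  also have "(`) ?h ` Pow H = Pow (?h ` H)" by (rule image_Pow_surj) (rule refl)
  also have "sum w (Pow (?h ` H)) = F (?h ` H)" using sum irr psubset.hyps by simp
  also have "\<dots> = sum w (Pow H)" using inv sum psubset by simp
  finally have "(\<Sum>C\<in>Pow H. w (?h ` C)) = sum w (Pow H)" .
  moreover have "(\<Sum>C\<in>Pow H. w (?h ` C)) = w (?h ` H) + (\<Sum>C\<in>Pow H - {H}. w (?h ` C))"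
    using psubset.hyps by (intro sum.remove) auto
  moreover have "sum w (Pow H) = w H + sum w (Pow H - {H})"
    using psubset.hyps by (intro sum.remove) auto
  ultimately show ?case using IH by simp
qed

section \<open>The grid as a subgraph of the lattice\<close>

text \<open>
  Vertices are sequences supported on the first \<open>k\<close> coordinates, so that translations are pointwise
  additions. Separate side lengths are allowed because the possible positions of a shape in a cube form
  such a box.
\<close>

definition box :: "nat \<Rightarrow> (nat \<Rightarrow> nat) \<Rightarrow> (nat \<Rightarrow> nat) set" where
  "box k f = {u. (\<forall>i<k. u i < f i) \<and> (\<forall>i\<ge>k. u i = 0)}"

definition lattice :: "nat \<Rightarrow> (nat \<Rightarrow> nat) rel" where
  "lattice k = {(u, v). \<exists>i<k. v = u(i := Suc (u i)) \<or> u = v(i := Suc (v i))}"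

definition grid :: "nat \<Rightarrow> nat \<Rightarrow> (nat \<Rightarrow> nat) rel" where
  "grid k q = lattice k \<inter> box k (\<lambda>_. q) \<times> box k (\<lambda>_. q)"

lemma box_less: "u \<in> box k f \<Longrightarrow> i < k \<Longrightarrow> u i < f i"
  by (simp add: box_def)

lemma box_zero: "u \<in> box k f \<Longrightarrow> k \<le> i \<Longrightarrow> u i = 0"
  by (simp add: box_def)

lemma bij_betw_box: "bij_betw (\<lambda>u. restrict u {..<k}) (box k f) (\<Pi>\<^sub>E i\<in>{..<k}. {..<f i})"
proof (rule bij_betw_byWitness[where f' = "\<lambda>u i. if i < k then u i else 0"])
  show "\<forall>u\<in>box k f. (\<lambda>i. if i < k then restrict u {..<k} i else 0) = u"
    by (auto simp: box_def)
  show "\<forall>u\<in>\<Pi>\<^sub>E i\<in>{..<k}. {..<f i}. restrict (\<lambda>i. if i < k then u i else 0) {..<k} = u"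
  proof (intro ballI ext)
    fix u i assume "u \<in> (\<Pi>\<^sub>E i\<in>{..<k}. {..<f i})"
    then have "i \<notin> {..<k} \<Longrightarrow> u i = undefined" by (rule PiE_arb)
    then show "restrict (\<lambda>i. if i < k then u i else 0) {..<k} i = u i"
      unfolding restrict_def by (cases "i < k") auto
  qed
  show "(\<lambda>u. restrict u {..<k}) ` box k f \<subseteq> (\<Pi>\<^sub>E i\<in>{..<k}. {..<f i})"
    unfolding box_def by (rule image_subsetI, simp only: restrict_PiE_iff) blast
  show "(\<lambda>u i. if i < k then u i else 0) ` (\<Pi>\<^sub>E i\<in>{..<k}. {..<f i}) \<subseteq> box k f"
  proof (rule image_subsetI)
    fix u assume u: "u \<in> (\<Pi>\<^sub>E i\<in>{..<k}. {..<f i})"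
    have "u i < f i" if "i < k" for i using PiE_mem[OF u, of i] that by simp
    then show "(\<lambda>i. if i < k then u i else 0) \<in> box k f" unfolding box_def by simp
  qed
qed

lemma card_box: "card (box k f) = (\<Prod>i<k. f i)"
  using bij_betw_same_card[OF bij_betw_box[of k f]] by (simp add: card_PiE)

lemma finite_box [simp]: "finite (box k f)"
  using bij_betw_finite[OF bij_betw_box[of k f]] by (simp add: finite_PiE)

lemma finite_grid [simp]: "finite (grid k q)"
  by (rule finite_subset[of _ "box k (\<lambda>_. q) \<times> box k (\<lambda>_. q)"]) (auto simp: grid_def)

lemma irrefl_lattice: "irrefl (lattice k)"
  by (auto simp: lattice_def irrefl_def fun_eq_iff)

lemma irrefl_grid: "irrefl (grid k q)"
  using irrefl_lattice by (auto simp: grid_def irrefl_def)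

lemma parcs_cart_power_path_graph:
  "(us, vs) \<in> parcs (cart_power (path_graph q) k) \<longleftrightarrow>
    length us = k \<and> length vs = k \<and> set us \<subseteq> {..<q} \<and> set vs \<subseteq> {..<q} \<and>
    (\<exists>i<k. vs = us[i := Suc (us ! i)] \<or> us = vs[i := Suc (vs ! i)])"
proof (induction k arbitrary: us vs)
  case (Suc k)
  have arcs: "(us, vs) \<in> parcs (cart_power (path_graph q) (Suc k)) \<longleftrightarrow>
    (\<exists>u us' v vs'. us = u # us' \<and> vs = v # vs' \<and>
      (u = v \<and> u < q \<and> (us', vs') \<in> parcs (cart_power (path_graph q) k) \<or>
       us' = vs' \<and> length us' = k \<and> set us' \<subseteq> {..<q} \<and> u < q \<and> v < q \<and> (v = Suc u \<or> u = Suc v)))"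
    by (force simp: map_graph_def cart_prod_def path_graph_def pverts_cart_power image_iff)
  show ?case
  proof (cases "length us = Suc k \<and> length vs = Suc k")
    case True
    then obtain u us' v vs' where "us = u # us'" "vs = v # vs'" "length us' = k" "length vs' = k"
      by (auto simp: length_Suc_conv)
    then show ?thesis
      unfolding arcs Ex_less_Suc2 by (auto simp: Suc.IH)
  next
    case False
    moreover have "length us' = k \<and> length vs' = k"
      if "(us', vs') \<in> parcs (cart_power (path_graph q) k)" for us' vs'
      using that unfolding Suc.IH by (elim conjE) (intro conjI)
    then have "length us = Suc k \<and> length vs = Suc k"
      if "(us, vs) \<in> parcs (cart_power (path_graph q) (Suc k))"
      using that unfolding arcs by force
    ultimately show ?thesis by blast
  qed
qed simp

lemma nth_default_list_update:
  "i < length us \<Longrightarrow> nth_default d (us[i := x]) = (nth_default d us)(i := x)"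
  by (auto simp: fun_eq_iff nth_default_def nth_list_update)

lemma nth_default_inj:
  assumes "nth_default d us = nth_default d vs" "length us = length vs"
  shows "us = vs"
  using assms by (intro nth_equalityI) (metis nth_default_nth)+

text \<open>
  Padding lists of length \<open>k\<close> with zeros identifies the product of paths with the grid.
\<close>

lemma grid_eq_image_parcs:
  "grid k q = map_prod (nth_default 0) (nth_default 0) ` parcs (cart_power (path_graph q) k)"
proof (intro set_eqI iffI; clarify)
  fix u v assume uv: "(u, v) \<in> grid k q"
  define us vs where "us = map u [0..<k]" and "vs = map v [0..<k]"
  have u: "nth_default 0 us = u" and v: "nth_default 0 vs = v"
    using uv by (auto simp: us_def vs_def grid_def box_def nth_default_def fun_eq_iff)
  obtain i where i: "i < k" "v = u(i := Suc (u i)) \<or> u = v(i := Suc (v i))"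
    using uv by (auto simp: grid_def lattice_def)
  have len: "length us = k" "length vs = k" by (simp_all add: us_def vs_def)
  have "us ! i = u i" "vs ! i = v i" using i by (simp_all add: us_def vs_def)
  then have "nth_default 0 vs = nth_default 0 (us[i := Suc (us ! i)]) \<or>
      nth_default 0 us = nth_default 0 (vs[i := Suc (vs ! i)])"
    using i len u v by (simp add: nth_default_list_update)
  then have "vs = us[i := Suc (us ! i)] \<or> us = vs[i := Suc (vs ! i)]"
    using len by (metis length_list_update nth_default_inj)
  moreover have "set us \<subseteq> {..<q}" "set vs \<subseteq> {..<q}"
    using uv by (auto simp: us_def vs_def grid_def box_def)
  ultimately have "(us, vs) \<in> parcs (cart_power (path_graph q) k)"
    using i len unfolding parcs_cart_power_path_graph by blast
  then show "(u, v) \<in> map_prod (nth_default 0) (nth_default 0) ` parcs (cart_power (path_graph q) k)"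
    using u v by force
next
  fix us vs assume "(us, vs) \<in> parcs (cart_power (path_graph q) k)"
  then obtain i where *: "length us = k" "length vs = k" "set us \<subseteq> {..<q}" "set vs \<subseteq> {..<q}" "i < k"
      "vs = us[i := Suc (us ! i)] \<or> us = vs[i := Suc (vs ! i)]"
    unfolding parcs_cart_power_path_graph by blast
  have "nth_default 0 ws \<in> box k (\<lambda>_. q)" if "length ws = k" "set ws \<subseteq> {..<q}" for ws
    using that nth_mem by (fastforce simp: box_def nth_default_def)
  moreover have "(nth_default 0 us, nth_default 0 vs) \<in> lattice k"
    using * nth_default_list_update[of i us 0 "Suc (us ! i)"] nth_default_list_update[of i vs 0 "Suc (vs ! i)"]
    by (auto simp: lattice_def nth_default_def)
  ultimately show "(nth_default 0 us, nth_default 0 vs) \<in> grid k q"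
    using * by (simp add: grid_def)
qed

lemma whitney_series_cart_power_path_graph:
  "whitney_series (parcs (cart_power (path_graph q) k)) = whitney_series (grid k q)"
proof -
  have "finite (parcs (cart_power (path_graph q) k))"
    by (intro finite_parcs pair_graph_cart_power pair_graph_path_graph)
  moreover have "inj_on (nth_default 0) (Field (parcs (cart_power (path_graph q) k)))"
    by (intro inj_onI) (auto simp: Field_def parcs_cart_power_path_graph intro: nth_default_inj)
  ultimately show ?thesis
    unfolding grid_eq_image_parcs by (rule whitney_series_image[symmetric])
qed

section \<open>Connected clusters in the grid and their translates\<close>

text \<open>
  If \<open>H\<close> is connected and reaches from coordinate value \<open>u i\<close> up to \<open>v i\<close>, then for every level \<open>x\<close> in
  between a spanning forest has an edge crossing from \<open>x\<close> to \<open>x + 1\<close>, as otherwise the level would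
  separate \<open>H\<close>. An edge of the lattice crosses only one level, so these edges are distinct.
\<close>

lemma extent_le_rank:
  assumes H: "finite H" "H \<subseteq> lattice k" "\<not> vertex_disconnected H" and uv: "u \<in> Field H" "v \<in> Field H"
  shows "v i \<le> u i + rank H"
proof -
  obtain B where B: "B \<subseteq> H" "finite B" "H \<subseteq> connection B" "card B = rank H"
    using rank_witness[OF H(1)] .
  let ?low = "\<lambda>(x, y). min (x i) (y i)"
  \<comment> \<open>An edge crossing the level between \<open>x\<close> and \<open>x + 1\<close> has \<open>x\<close> as its lower value.\<close>
  have "x \<in> ?low ` B" if x: "x \<in> {u i..<v i}" for x
  proof (rule ccontr)
    assume no: "x \<notin> ?low ` B"
    have "(a i \<le> x) = (b i \<le> x)" if "(a, b) \<in> B" for a b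
    proof -
      have "(a, b) \<in> lattice k" using that B H by auto
      then have "a i \<le> Suc (b i)" "b i \<le> Suc (a i)" by (auto simp: lattice_def)
      moreover have "x \<noteq> min (a i) (b i)" using no that by force
      ultimately show ?thesis by linarith
    qed
    then have same: "(a i \<le> x) = (b i \<le> x)" if "(a, b) \<in> H" for a b
      using connection_const[of a b B "\<lambda>y. y i \<le> x"] that B(3) by blast
    define A where "A = {(a, b) \<in> H. a i \<le> x}"
    define A' where "A' = {(a, b) \<in> H. \<not> a i \<le> x}"
    have "w i \<le> x" if "w \<in> Field A" for w using that same by (auto simp: A_def Field_def)
    moreover have "\<not> w i \<le> x" if "w \<in> Field A'" for w using that same by (auto simp: A'_def Field_def)
    ultimately have "Field A \<inter> Field A' = {}" by blast
    moreover have "A \<noteq> {}" using uv(1) x same by (auto simp: A_def Field_def)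
    moreover have "A' \<noteq> {}" using uv(2) x same by (fastforce simp: A'_def Field_def)
    moreover have "H = A \<union> A'" by (auto simp: A_def A'_def)
    ultimately show False using H(3) unfolding vertex_disconnected_def by blast
  qed
  then have "card {u i..<v i} \<le> card (?low ` B)" using B(2) by (intro card_mono) auto
  also have "\<dots> \<le> card B" using B(2) by (rule card_image_le)
  finally show ?thesis using B(4) by simp
qed

lemma Field_map_prod: "Field (map_prod h h ` H) = h ` Field H"
  by (force simp: Field_def)

lemma vertex_disconnected_image:
  assumes "inj_on h (Field H)" "vertex_disconnected H"
  shows "vertex_disconnected (map_prod h h ` H)"
proof -
  obtain A B where AB: "H = A \<union> B" "A \<noteq> {}" "B \<noteq> {}" "Field A \<inter> Field B = {}"
    using assms(2) unfolding vertex_disconnected_def by blast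
  have "h ` Field A \<inter> h ` Field B = h ` (Field A \<inter> Field B)"
    using AB(1) assms(1) by (intro inj_on_image_Int[symmetric]) auto
  then have "Field (map_prod h h ` A) \<inter> Field (map_prod h h ` B) = {}"
    using AB(4) by (simp add: Field_map_prod)
  moreover have "map_prod h h ` H = map_prod h h ` A \<union> map_prod h h ` B"
    using AB(1) by (simp add: image_Un)
  ultimately show ?thesis
    unfolding vertex_disconnected_def using AB(2,3) by (metis image_is_empty)
qed

definition shift :: "(nat \<Rightarrow> nat) \<Rightarrow> (nat \<Rightarrow> nat) \<Rightarrow> nat \<Rightarrow> nat" where
  "shift p u = (\<lambda>i. u i + p i)"

definition unshift :: "(nat \<Rightarrow> nat) \<Rightarrow> (nat \<Rightarrow> nat) \<Rightarrow> nat \<Rightarrow> nat" where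
  "unshift p u = (\<lambda>i. u i - p i)"

lemma unshift_shift [simp]: "unshift p (shift p u) = u"
  by (simp add: shift_def unshift_def)

lemma inj_shift: "inj (shift p)"
  by (metis injI unshift_shift)

definition clusters :: "nat \<Rightarrow> nat \<Rightarrow> nat \<Rightarrow> (nat \<Rightarrow> nat) rel set" where
  "clusters k q r = {H. H \<subseteq> grid k q \<and> H \<noteq> {} \<and> \<not> vertex_disconnected H \<and> rank H \<le> r}"

definition corner :: "(nat \<Rightarrow> nat) rel \<Rightarrow> nat \<Rightarrow> nat" where
  "corner H i = Min ((\<lambda>u. u i) ` Field H)"

definition extent :: "(nat \<Rightarrow> nat) rel \<Rightarrow> nat \<Rightarrow> nat" where
  "extent S i = Max ((\<lambda>u. u i) ` Field S)"

text \<open>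
  Representatives of the translation classes of clusters, pushed against the coordinate hyperplanes.
  Side length \<open>r + 1\<close> loses none of them, by the bound on the extent.
\<close>

definition shapes :: "nat \<Rightarrow> nat \<Rightarrow> (nat \<Rightarrow> nat) rel set" where
  "shapes k r = {S \<in> clusters k (Suc r) r. \<forall>i<k. \<exists>u\<in>Field S. u i = 0}"

lemma finite_clusters [simp]: "finite (clusters k q r)"
  by (rule finite_subset[of _ "Pow (grid k q)"]) (auto simp: clusters_def)

lemma finite_shapes [simp]: "finite (shapes k r)"
  by (simp add: shapes_def)

lemma clustersD:
  assumes "H \<in> clusters k q r"
  shows "finite H" "irrefl H" "H \<subseteq> lattice k" "Field H \<subseteq> box k (\<lambda>_. q)" "finite (Field H)" "Field H \<noteq> {}"
    "\<not> vertex_disconnected H" "rank H \<le> r"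
proof -
  have H: "H \<subseteq> grid k q" "H \<noteq> {}" "\<not> vertex_disconnected H" "rank H \<le> r"
    using assms by (auto simp: clusters_def)
  show "irrefl H" using H(1) irrefl_grid[of k q] by (auto simp: irrefl_def)
  show "finite H" using H(1) finite_grid by (rule finite_subset)
  then show "finite (Field H)" by (simp add: finite_Field)
  show "H \<subseteq> lattice k" "Field H \<subseteq> box k (\<lambda>_. q)" using H(1) by (auto simp: grid_def Field_def)
  show "Field H \<noteq> {}" using H(2) by (auto simp: Field_def)
  show "\<not> vertex_disconnected H" "rank H \<le> r" by fact+
qed

lemma clustersI:
  assumes "H \<subseteq> lattice k" "Field H \<subseteq> box k (\<lambda>_. q)" "H \<noteq> {}" "\<not> vertex_disconnected H" "rank H \<le> r"
  shows "H \<in> clusters k q r"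
  using assms by (auto simp: clusters_def grid_def intro: FieldI1 FieldI2)

text \<open>
  A cluster is determined by its shape and the lowest corner of its bounding box, and the corner may be
  placed wherever the bounding box stays inside the grid.
\<close>

lemma bij_betw_clusters:
  "bij_betw (\<lambda>(S, p). map_prod (shift p) (shift p) ` S)
     (SIGMA S:shapes k r. box k (\<lambda>i. q - extent S i)) (clusters k q r)"
proof -
  let ?T = "\<lambda>(S, p). map_prod (shift p) (shift p) ` S"
  let ?U = "\<lambda>H. (map_prod (unshift (corner H)) (unshift (corner H)) ` H, corner H)"
  let ?D = "SIGMA S:shapes k r. box k (\<lambda>i. q - extent S i)"
  have fwd: "?T (S, p) \<in> clusters k q r" "?U (?T (S, p)) = (S, p)" if "(S, p) \<in> ?D" for S p
  proof -
    have S: "S \<in> clusters k (Suc r) r" "\<And>i. i < k \<Longrightarrow> \<exists>u\<in>Field S. u i = 0"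
      and p: "\<And>i. i < k \<Longrightarrow> p i < q - extent S i" "\<And>i. i \<ge> k \<Longrightarrow> p i = 0"
      using that by (auto simp: shapes_def box_def)
    note SD = clustersD[OF S(1)]
    have restored: "map_prod (unshift p) (unshift p) ` ?T (S, p) = S"
      by (simp add: image_image map_prod_def case_prod_unfold)
    have zero: "\<exists>u\<in>Field S. u i = 0" for i
    proof (cases "i < k")
      case False
      obtain u where "u \<in> Field S" using SD(6) by blast
      then show ?thesis using SD(4) False box_zero[of u k _ i] by fastforce
    qed (rule S(2))
    have le_extent: "u i \<le> extent S i" if "u \<in> Field S" for u i
      unfolding extent_def using that SD(5) by (intro Max_ge) auto
    have "shift p u \<in> box k (\<lambda>_. q)" if u: "u \<in> Field S" for u
    proof -
      have "u i + p i < q" if "i < k" for i using p(1)[OF that] le_extent[OF u, of i] by linarith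
      moreover have "u i + p i = 0" if "i \<ge> k" for i
        using p(2)[OF that] box_zero[of u k _ i] SD(4) u that by auto
      ultimately show ?thesis by (simp add: box_def shift_def)
    qed
    then have "Field (?T (S, p)) \<subseteq> box k (\<lambda>_. q)" by (auto simp: Field_map_prod)
    moreover have "(shift p u, shift p v) \<in> lattice k" if "(u, v) \<in> lattice k" for u v
      using that by (auto simp: lattice_def shift_def fun_eq_iff)
    then have "?T (S, p) \<subseteq> lattice k" using SD(3) by auto
    moreover have "\<not> vertex_disconnected (?T (S, p))"
    proof
      assume "vertex_disconnected (?T (S, p))"
      moreover have "inj_on (unshift p) (Field (?T (S, p)))"
        by (auto simp: Field_map_prod inj_on_def)
      ultimately show False using vertex_disconnected_image[of "unshift p" "?T (S, p)"] restored SD(7) by simp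
    qed
    moreover have "rank (?T (S, p)) \<le> r" using rank_image_le[OF SD(1)] SD(8) by (auto intro: le_trans)
    moreover have "?T (S, p) \<noteq> {}" using SD(6) by (auto simp: Field_def)
    ultimately show "?T (S, p) \<in> clusters k q r" by (intro clustersI)
    have "corner (?T (S, p)) i = p i" for i
      unfolding corner_def
    proof (rule Min_eqI)
      show "finite ((\<lambda>u. u i) ` Field (?T (S, p)))" using SD(5) by (simp add: Field_map_prod)
      obtain u where u: "u \<in> Field S" "u i = 0" using zero[of i] by blast
      then have shifted: "shift p u \<in> Field (?T (S, p))" by (simp add: Field_map_prod)
      have "p i = shift p u i" using u by (simp add: shift_def)
      then show "p i \<in> (\<lambda>u. u i) ` Field (?T (S, p))" using shifted by (rule image_eqI)
    qed (auto simp: Field_map_prod shift_def)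
    then have "corner (?T (S, p)) = p" by auto
    then show "?U (?T (S, p)) = (S, p)" using restored by simp
  qed
  have bwd: "?U H \<in> ?D" "?T (?U H) = H" if H: "H \<in> clusters k q r" for H
  proof -
    note HD = clustersD[OF H]
    define c where "c = corner H"
    define S where "S = map_prod (unshift c) (unshift c) ` H"
    have le: "c i \<le> u i" if "u \<in> Field H" for u i
      unfolding c_def corner_def using that HD(5) by (intro Min_le) auto
    have attained: "\<exists>u\<in>Field H. u i = c i" for i
    proof -
      have "c i \<in> (\<lambda>u. u i) ` Field H"
        unfolding c_def corner_def using HD(5,6) by (intro Min_in) simp_all
      then show ?thesis by force
    qed
    have shift_unshift: "shift c (unshift c u) = u" if "u \<in> Field H" for u
      using le[OF that] by (simp add: shift_def unshift_def)
    have "map_prod (shift c) (shift c) (map_prod (unshift c) (unshift c) e) = e" if "e \<in> H" for e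
      using that shift_unshift by (cases e) (auto intro: FieldI1 FieldI2)
    then have restored: "map_prod (shift c) (shift c) ` S = H"
      unfolding S_def image_image by force
    have FS: "Field S = unshift c ` Field H" by (simp add: S_def Field_map_prod)
    have "u i < Suc (c i + r)" if "u \<in> Field H" for u i
      using attained[of i] extent_le_rank[OF HD(1,3,7) _ that, of _ i] HD(8) by fastforce
    then have "unshift c u \<in> box k (\<lambda>_. Suc r)" if "u \<in> Field H" for u
    proof -
      have "u i - c i < Suc r" for i
        using \<open>\<And>u i. u \<in> Field H \<Longrightarrow> u i < Suc (c i + r)\<close>[OF that, of i] by linarith
      moreover have "u i - c i = 0" if "i \<ge> k" for i
        using box_zero[of u k _ i] HD(4) \<open>u \<in> Field H\<close> that by auto
      ultimately show ?thesis by (simp add: box_def unshift_def)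
    qed
    then have "Field S \<subseteq> box k (\<lambda>_. Suc r)" unfolding FS by blast
    moreover have "S \<subseteq> lattice k"
    proof -
      have "(unshift c u, unshift c v) \<in> lattice k" if "(u, v) \<in> H" for u v
      proof -
        have "(u, v) \<in> lattice k" using HD(3) that by blast
        then obtain i where "i < k" "v = u(i := Suc (u i)) \<or> u = v(i := Suc (v i))"
          unfolding lattice_def by blast
        moreover have "c i \<le> u i" "c i \<le> v i" using le that by (auto intro: FieldI1 FieldI2)
        ultimately have "unshift c v = (unshift c u)(i := Suc (unshift c u i)) \<or>
            unshift c u = (unshift c v)(i := Suc (unshift c v i))"
          by (auto simp: unshift_def fun_eq_iff Suc_diff_le)
        then show ?thesis using \<open>i < k\<close> by (auto simp: lattice_def)
      qed
      then show ?thesis by (auto simp: S_def)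
    qed
    moreover have "\<not> vertex_disconnected S"
      using vertex_disconnected_image[of "shift c" S] inj_shift restored HD(7)
      by (auto intro: inj_on_subset)
    moreover have "rank S \<le> r" using rank_image_le[OF HD(1)] HD(8) unfolding S_def by (rule le_trans)
    moreover have "S \<noteq> {}" using HD(6) by (auto simp: S_def Field_def)
    ultimately have "S \<in> clusters k (Suc r) r" by (intro clustersI)
    moreover have "\<exists>u\<in>Field S. u i = 0" for i
    proof -
      obtain u where u: "u \<in> Field H" "u i = c i" using attained by blast
      then have "unshift c u i = 0" by (simp add: unshift_def)
      then show ?thesis unfolding FS using u(1) by blast
    qed
    ultimately have "S \<in> shapes k r" by (simp add: shapes_def)
    moreover have "c i < q - extent S i" if "i < k" for i
    proof -
      have "extent S i \<in> (\<lambda>u. u i) ` Field S"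
        unfolding extent_def using HD(5,6) by (intro Max_in) (auto simp: FS)
      then obtain u where u: "u \<in> Field H" "extent S i = u i - c i" by (auto simp: FS unshift_def)
      moreover have "u i < q" using u(1) HD(4) that box_less[of u k "\<lambda>_. q" i] by blast
      ultimately show ?thesis using le[OF u(1), of i] by linarith
    qed
    moreover have "c i = 0" if "i \<ge> k" for i
    proof -
      obtain u where "u \<in> box k (\<lambda>_. q)" "u i = c i" using attained[of i] HD(4) by blast
      then show ?thesis using box_zero that by metis
    qed
    ultimately have "(S, c) \<in> ?D" by (simp add: box_def)
    then show "?U H \<in> ?D" by (simp add: S_def c_def)
    show "?T (?U H) = H" using restored by (simp add: S_def c_def)
  qed
  show ?thesis
  proof (rule bij_betw_byWitness[where f' = ?U])
    show "\<forall>P\<in>?D. ?U (?T P) = P"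
    proof
      fix P assume "P \<in> ?D"
      then show "?U (?T P) = P" by (cases P) (simp only: fwd(2))
    qed
    show "?T ` ?D \<subseteq> clusters k q r"
    proof (rule image_subsetI)
      fix P assume "P \<in> ?D"
      then show "?T P \<in> clusters k q r" by (cases P) (simp only: fwd(1))
    qed
    show "\<forall>H\<in>clusters k q r. ?T (?U H) = H" by (rule ballI) (rule bwd(2))
    show "?U ` clusters k q r \<subseteq> ?D" by (rule image_subsetI) (rule bwd(1))
  qed
qed

lemma extent_le:
  assumes "S \<in> shapes k r" "i < k"
  shows "extent S i \<le> r"
proof -
  have S: "S \<in> clusters k (Suc r) r" using assms(1) by (simp add: shapes_def)
  show ?thesis
    unfolding extent_def
  proof (rule Max.boundedI)
    fix x assume "x \<in> (\<lambda>u. u i) ` Field S"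
    then obtain u where "u \<in> box k (\<lambda>_. Suc r)" "x = u i" using clustersD(4)[OF S] by blast
    then show "x \<le> r" using assms(2) by (simp add: box_def less_Suc_eq_le)
  qed (use clustersD(5,6)[OF S] in simp_all)
qed

section \<open>Polynomial dependence on the side length\<close>

text \<open>
  Group the clusters by shape. The truncated differences \<open>q - extent S i\<close> are genuine ones for
  \<open>q \<ge> r\<close>, which makes the number of positions a polynomial in \<open>q\<close>.
\<close>

lemma log_deriv_series_grid:
  "\<exists>\<psi> :: rat poly. \<forall>q\<ge>r. log_deriv_series (grid k q) $ r = poly \<psi> (of_nat q)"
proof -
  obtain w :: "(nat \<Rightarrow> nat) rel \<Rightarrow> rat" where
    local: "\<And>H. finite H \<Longrightarrow> r < rank H \<Longrightarrow> w H = 0" and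
    sum: "\<And>E. finite E \<Longrightarrow> irrefl E \<Longrightarrow> log_deriv_series E $ r = (\<Sum>H\<in>Pow E. w H)"
    using rank_localE[OF rank_local_log_deriv_series] by blast
  have disconnected: "w H = 0" if "finite H" "irrefl H" "vertex_disconnected H" for H
    using weight_disconnected[of "\<lambda>E. log_deriv_series E $ r" w H] sum that
    by (simp add: log_deriv_series_Un)
  have empty: "w {} = 0" using sum[of "{}"] by (simp add: irrefl_def)
  have translate: "w (map_prod (shift p) (shift p) ` H) = w H" if "finite H" "irrefl H" for p H
    using weight_image[of "\<lambda>E. log_deriv_series E $ r" w "shift p" H] sum that inj_shift
    by (simp add: log_deriv_series_image inj_on_subset[OF inj_shift])
  define \<psi> where "\<psi> = (\<Sum>S\<in>shapes k r. smult (w S) (\<Prod>i<k. [:- of_nat (extent S i), 1:]))"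
  have "log_deriv_series (grid k q) $ r = poly \<psi> (of_nat q)" if "q \<ge> r" for q
  proof -
    have "log_deriv_series (grid k q) $ r = (\<Sum>H\<in>Pow (grid k q). w H)"
      by (rule sum[OF finite_grid irrefl_grid])
    also have "\<dots> = (\<Sum>H\<in>clusters k q r. w H)"
    proof (rule sum.mono_neutral_right)
      show "\<forall>H\<in>Pow (grid k q) - clusters k q r. w H = 0"
      proof
        fix H assume H: "H \<in> Pow (grid k q) - clusters k q r"
        then have "finite H" by (auto intro: finite_subset[OF _ finite_grid])
        moreover have "irrefl H" using H irrefl_grid[of k q] by (auto simp: irrefl_def)
        ultimately show "w H = 0"
          using H empty local[of H] disconnected[of H] by (force simp: clusters_def)
      qed
    qed (auto simp: clusters_def)
    also have "\<dots> = (\<Sum>(S, p)\<in>(SIGMA S:shapes k r. box k (\<lambda>i. q - extent S i)).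
        w (map_prod (shift p) (shift p) ` S))"
      using sum.reindex_bij_betw[OF bij_betw_clusters, of w k r q] by (simp add: case_prod_unfold)
    also have "\<dots> = (\<Sum>S\<in>shapes k r. \<Sum>p\<in>box k (\<lambda>i. q - extent S i). w (map_prod (shift p) (shift p) ` S))"
      by (rule sum.Sigma[symmetric]) auto
    also have "\<dots> = (\<Sum>S\<in>shapes k r. w S * (\<Prod>i<k. of_nat q - of_nat (extent S i)))"
    proof (rule sum.cong)
      fix S assume S: "S \<in> shapes k r"
      then have "S \<in> clusters k (Suc r) r" by (simp add: shapes_def)
      then have w: "w (map_prod (shift p) (shift p) ` S) = w S" for p
        using translate clustersD(1,2)[of S k "Suc r" r] by simp
      have "(\<Prod>i<k. of_nat (q - extent S i) :: rat) = (\<Prod>i<k. of_nat q - of_nat (extent S i))"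
      proof (rule prod.cong)
        fix i assume "i \<in> {..<k}"
        then have "extent S i \<le> q" using extent_le[OF S, of i] that by simp
        then show "(of_nat (q - extent S i) :: rat) = of_nat q - of_nat (extent S i)"
          by (rule of_nat_diff)
      qed (rule refl)
      then show "(\<Sum>p\<in>box k (\<lambda>i. q - extent S i). w (map_prod (shift p) (shift p) ` S)) =
          w S * (\<Prod>i<k. of_nat q - of_nat (extent S i))"
        unfolding w sum_constant card_box by simp
    qed (rule refl)
    also have "\<dots> = poly \<psi> (of_nat q)" by (simp add: \<psi>_def poly_sum poly_prod)
    finally show ?thesis .
  qed
  then show ?thesis by blast
qed

text \<open>
  The indices \<open>i\<close> and \<open>r - i\<close> in Newton's identity are at most \<open>r\<close>, so the range \<open>q \<ge> r\<close> is preserved.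
\<close>

lemma whitney_series_grid:
  "\<exists>\<phi> :: rat poly. \<forall>q\<ge>r. whitney_series (grid k q) $ r = poly \<phi> (of_nat q)"
proof (induction r rule: less_induct)
  case (less r)
  show ?case
  proof (cases "r = 0")
    case True
    then show ?thesis
      by (intro exI[of _ 1]) (simp add: whitney_series_nth_0 irrefl_grid)
  next
    case False
    obtain \<psi> :: "nat \<Rightarrow> rat poly" where
      \<psi>: "\<And>r q. q \<ge> r \<Longrightarrow> log_deriv_series (grid k q) $ r = poly (\<psi> r) (of_nat q)"
      using log_deriv_series_grid[of _ k] by metis
    obtain \<phi> :: "nat \<Rightarrow> rat poly" where
      \<phi>: "\<And>j q. j < r \<Longrightarrow> q \<ge> j \<Longrightarrow> whitney_series (grid k q) $ j = poly (\<phi> j) (of_nat q)"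
      using less.IH by metis
    let ?\<phi> = "smult (1 / of_nat r) (\<psi> r + (\<Sum>i=1..<r. \<psi> i * \<phi> (r - i)))"
    have "whitney_series (grid k q) $ r = poly ?\<phi> (of_nat q)" if "q \<ge> r" for q
    proof -
      have "of_nat r * whitney_series (grid k q) $ r =
          poly (\<psi> r) (of_nat q) + (\<Sum>i=1..<r. poly (\<psi> i) (of_nat q) * poly (\<phi> (r - i)) (of_nat q))"
        using that False newton_identity[OF finite_grid irrefl_grid, of r k q]
        by (simp add: \<psi> \<phi>)
      then show ?thesis using False by (simp add: poly_sum field_simps)
    qed
    then show ?thesis by blast
  qed
qed

theorem theorem47:
  fixes k :: nat
  assumes "k > 0"
  shows "two_level_polynomial (monom 1 k) (\<lambda>q. ereal (real q))
           (\<lambda>q. chromatic_poly (cart_power (path_graph q) k))"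
proof -
  let ?G = "\<lambda>q. cart_power (path_graph q) k"
  have G: "pair_graph (?G q)" for q by (rule pair_graph_cart_power[OF pair_graph_path_graph])
  have V: "card (pverts (?G q)) = q ^ k" for q
    using card_lists_length_eq[of "{..<q}" k]
    by (simp add: pverts_cart_power path_graph_def conj_commute)
  obtain \<phi> :: "nat \<Rightarrow> rat poly" where
    \<phi>: "\<And>r q. q \<ge> r \<Longrightarrow> whitney_series (grid k q) $ r = poly (\<phi> r) (of_nat q)"
    using whitney_series_grid[of _ k] by metis
  have "top_coeff (chromatic_poly (?G q)) r = poly (\<phi> r) (of_nat q)" if "r \<le> q" for q r
  proof -
    \<comment> \<open>The degree \<open>q ^ k\<close> is at least \<open>q\<close>, so \<open>top_coeff\<close> is never cut off within the depth.\<close>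
    have "q \<le> q ^ k" using assms by (cases "q = 0") (auto intro: self_le_power)
    then have r: "r \<le> q ^ k" using that by simp
    then have "top_coeff (chromatic_poly (?G q)) r = coeff (chromatic_poly (?G q)) (card (pverts (?G q)) - r)"
      by (simp add: top_coeff_def degree_chromatic_poly[OF G] V)
    also have "\<dots> = whitney_series (grid k q) $ r"
      using coeff_chromatic_poly[OF G, of r q] r V by (simp add: whitney_series_cart_power_path_graph)
    finally show ?thesis using \<phi> that by simp
  qed
  then show ?thesis
    unfolding two_level_polynomial_def numerical_poly_def eventually_nonneg_poly_def
    by (auto simp: poly_monom degree_chromatic_poly[OF G] V intro!: exI[of _ \<phi>])
qed

end
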